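(* Consider the following linear encoding of CLIQUE on graphs with at most $n$ vertices: the dimension is $d = n^2$ with variables $x \in \mathbb{R}^{n\times n}$; the feasible solutions are the matrices $x = bb^\intercal$ with $b \in \{0,1\}^n$ (so the inner polytope is $P = \mathrm{conv}\{bb^\intercal \mid b\in\{0,1\}^n\}$); the admissible objective functions are the matrices $w^G$ for all graphs $G$ with $V(G)\subseteq[n]$, and the problem is to maximize $\langle w^G, x\rangle$ (whose maximum over feasible $x$ is $\omega(G)$). With respect to this encoding, CLIQUE has an $n$-approximate EF of size $O(n^2)$. Moreover, for every $0 < \epsilon < 1/2$, every $n^{1/2-\epsilon}$-approximate EF of CLIQUE has size $2^{\Omega(n^{2\epsilon})}$.
   Context: $\langle\cdot,\cdot\rangle$ is the Frobenius inner product and $\omega(G)$ the clique number. For a graph $G$ with $V(G)\subseteq [n]$, $w^G\in\mathbb{R}^{n\times n}$ has $w^G_{ii} = 1$ for $i \in V(G)$, $w^G_{ii} = 0$ for $i \notin V(G)$, $w^G_{ij} = w^G_{ji} = -1$ if $i\ne j$, $i,j\in V(G)$, $ij\notin E(G)$, and $w^G_{ij}=0$ otherwise. A $\rho$-approximate EF (for $\rho\geqslant1$) is a linear system $Ex + Fy = g$, $y \geqslant \mathbf 0$, $y\in\mathbb{R}^r$, whose projection $K = \{x \mid \exists y: Ex+Fy=g, y\geqslant \mathbf 0\}$ satisfies $\max_{x\in K}\langle w,x\rangle \geqslant \max_{x\in P}\langle w,x\rangle$ for all $w\in\mathbb{R}^{n\times n}$ and $\max_{x\in K}\langle w^G,x\rangle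 \leqslant \rho\max_{x\in P}\langle w^G,x\rangle$ for every graph $G$ with $V(G)\subseteq[n]$; its size is $r$. *)

theory Defs
  imports Complex_Main "HOL-Library.Extended_Real"
begin

text \<open>Matrices in R^{n x n} are functions nat \<times> nat \<Rightarrow> real; only the
  entries with indices in [n] = {0..<n} are relevant.\<close>

definition frob :: "nat \<Rightarrow> (nat \<times> nat \<Rightarrow> real) \<Rightarrow> (nat \<times> nat \<Rightarrow> real) \<Rightarrow> real" where
  "frob n w x = (\<Sum>i<n. \<Sum>j<n. w (i, j) * x (i, j))"

definition clique_points :: "nat \<Rightarrow> (nat \<times> nat \<Rightarrow> real) set" where
  "clique_points n = {(\<lambda>(i, j). b i * b j) | b :: nat \<Rightarrow> real.
      (\<forall>i<n. b i \<in> {0, 1}) \<and> (\<forall>i\<ge>n. b i = 0)}"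

definition clique_polytope :: "nat \<Rightarrow> (nat \<times> nat \<Rightarrow> real) set" where
  "clique_polytope n = {x. \<exists>S c. finite S \<and> S \<subseteq> clique_points n \<and>
      (\<forall>p\<in>S. c p \<ge> 0) \<and> (\<Sum>p\<in>S. c p) = 1 \<and> x = (\<lambda>ij. \<Sum>p\<in>S. c p * p ij)}"

definition Pmax :: "nat \<Rightarrow> (nat \<times> nat \<Rightarrow> real) \<Rightarrow> real" where
  "Pmax n w = Sup (frob n w ` clique_polytope n)"

definition is_graph :: "nat \<Rightarrow> nat set \<Rightarrow> (nat \<Rightarrow> nat \<Rightarrow> bool) \<Rightarrow> bool" where
  "is_graph n V E \<longleftrightarrow> V \<subseteq> {..<n} \<and> (\<forall>i j. E i j \<longrightarrow> i \<in> V \<and> j \<in> V \<and> i \<noteq> j \<and> E j i)"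

definition wG :: "nat \<Rightarrow> nat set \<Rightarrow> (nat \<Rightarrow> nat \<Rightarrow> bool) \<Rightarrow> (nat \<times> nat \<Rightarrow> real)" where
  "wG n V E = (\<lambda>(i, j). if i = j then (if i \<in> V then 1 else 0)
      else if i \<in> V \<and> j \<in> V \<and> \<not> E i j then -1 else 0)"

definition ef_proj :: "nat \<Rightarrow> nat \<Rightarrow> nat \<Rightarrow> (nat \<Rightarrow> nat \<times> nat \<Rightarrow> real)
    \<Rightarrow> (nat \<Rightarrow> nat \<Rightarrow> real) \<Rightarrow> (nat \<Rightarrow> real) \<Rightarrow> (nat \<times> nat \<Rightarrow> real) set" where
  "ef_proj n m r E F g = {x. \<exists>y :: nat \<Rightarrow> real. (\<forall>l<r. y l \<ge> 0) \<and>
      (\<forall>k<m. frob n (E k) x + (\<Sum>l<r. F k l * y l) = g k)}"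

text \<open>rho-approximate EF of CLIQUE (maxima over K read as suprema in the extended reals).\<close>
definition approx_EF :: "nat \<Rightarrow> real \<Rightarrow> nat \<Rightarrow> nat \<Rightarrow> (nat \<Rightarrow> nat \<times> nat \<Rightarrow> real)
    \<Rightarrow> (nat \<Rightarrow> nat \<Rightarrow> real) \<Rightarrow> (nat \<Rightarrow> real) \<Rightarrow> bool" where
  "approx_EF n \<rho> m r E F g \<longleftrightarrow>
     (\<forall>w. (SUP x\<in>ef_proj n m r E F g. ereal (frob n w x)) \<ge> ereal (Pmax n w)) \<and>
     (\<forall>V Ed. is_graph n V Ed \<longrightarrow>
        (SUP x\<in>ef_proj n m r E F g. ereal (frob n (wG n V Ed) x))
          \<le> ereal (\<rho> * Pmax n (wG n V Ed)))"

end

(* Restricting an approximate extended formulation to the edgeless graphs on vertex sets a \<subseteq> [n],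
   Farkas' lemma turns it into a nonnegative factorization of rank r + 1 of the matrix
   \<rho> - 1 + (1 - |a \<inter> b|)^2. On disjoint pairs this matrix equals \<rho>, on pairs meeting in one element \<rho> - 1.
   A nonnegative rank-one matrix bounded by 1 cannot see a drop by the factor 1 - 1/\<rho> unless it has
   exponentially small mass: draw a random partition (A, U - A) of the ground set and subsets a \<subseteq> A,
   b \<subseteq> U - A. Conditioned on A the two factors are independent, and by the level-one inequality most
   coordinates are nearly unbiased in both, so adding a common element i to a and b changes the average
   by a factor 1 - O(t) up to an error t^{-1} \<Sum> bias^2, which is at most t^{-1} ln(1/mass). Taking
   t of order 1/\<rho> gives rank exp(\<Omega>(n/\<rho>^2)). For the upper bound, the box [0,1]^{n x n} suffices. *)
theory Submission
  imports Defs "HOL-Real_Asymp.Real_Asymp"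
begin

subsection \<open>Subcube averages and the level-one inequality\<close>

definition cube_avg :: "'a set \<Rightarrow> ('a set \<Rightarrow> real) \<Rightarrow> real" where
  "cube_avg A f = (\<Sum>a\<in>Pow A. f a) / 2 ^ card A"

lemma sum_Pow_insert:
  assumes "finite A" "i \<notin> A"
  shows "(\<Sum>a\<in>Pow (insert i A). f a) = (\<Sum>a\<in>Pow A. f a + f (insert i a))"
proof -
  have "inj_on (insert i) (Pow A)"
    using assms by (auto simp: inj_on_def)
  moreover have "Pow A \<inter> insert i ` Pow A = {}"
    using assms by auto
  ultimately show ?thesis
    using assms by (simp add: Pow_insert sum.union_disjoint sum.reindex sum.distrib)
qed

lemma cube_avg_insert:
  assumes "finite A" "i \<notin> A"
  shows "cube_avg (insert i A) f = (cube_avg A f + cube_avg A (\<lambda>a. f (insert i a))) / 2"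
  using assms by (simp add: cube_avg_def sum_Pow_insert sum.distrib field_simps)

lemma cube_avg_cong: "(\<And>a. a \<subseteq> A \<Longrightarrow> f a = g a) \<Longrightarrow> cube_avg A f = cube_avg A g"
  by (auto simp: cube_avg_def intro!: sum.cong)

lemma cube_avg_mono: "(\<And>a. a \<subseteq> A \<Longrightarrow> f a \<le> g a) \<Longrightarrow> cube_avg A f \<le> cube_avg A g"
  by (auto simp: cube_avg_def intro!: divide_right_mono sum_mono)

lemma cube_avg_const [simp]: "finite A \<Longrightarrow> cube_avg A (\<lambda>_. c) = c"
  by (simp add: cube_avg_def card_Pow)

lemma cube_avg_nonneg: "(\<And>a. a \<subseteq> A \<Longrightarrow> 0 \<le> f a) \<Longrightarrow> 0 \<le> cube_avg A f"
  by (auto simp: cube_avg_def intro!: sum_nonneg divide_nonneg_nonneg)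

lemma cube_avg_add: "cube_avg A (\<lambda>a. f a + g a) = cube_avg A f + cube_avg A g"
  by (simp add: cube_avg_def sum.distrib add_divide_distrib)

lemma cube_avg_sum: "cube_avg A (\<lambda>a. \<Sum>l\<in>I. f l a) = (\<Sum>l\<in>I. cube_avg A (f l))"
  unfolding cube_avg_def by (subst sum.swap) (simp add: sum_divide_distrib)

lemma cube_avg_cmult: "cube_avg A (\<lambda>a. c * f a) = c * cube_avg A f"
  by (simp add: cube_avg_def sum_distrib_left)

lemma cube_avg_cmult_right: "cube_avg A (\<lambda>a. f a * c) = cube_avg A f * c"
  by (simp add: cube_avg_def sum_distrib_right)

section \<open>Degree-one characters, Riesz products and biases\<close>

definition sgn_char :: "'a \<Rightarrow> 'a set \<Rightarrow> real" where
  "sgn_char i a = (if i \<in> a then 1 else -1)"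

text \<open>For a uniformly random subset the signs are independent with mean 0. With parameters in
  [-1, 1] the Riesz product is therefore a probability density; it is the test density of the
  level-one inequality.\<close>

lemma cube_avg_riesz:
  assumes "finite A"
  shows "cube_avg A (\<lambda>a. \<Prod>i\<in>A. 1 + \<theta> i * sgn_char i a) = 1"
  using assms
proof (induction A)
  case empty
  then show ?case by (simp add: cube_avg_def)
next
  case (insert k A)
  have 1: "cube_avg A (\<lambda>a. \<Prod>i\<in>insert k A. 1 + \<theta> i * sgn_char i a) = (1 - \<theta> k) * cube_avg A (\<lambda>a. \<Prod>i\<in>A. 1 + \<theta> i * sgn_char i a)"
    unfolding cube_avg_cmult [symmetric]
    using insert.hyps by (intro cube_avg_cong) (auto simp: sgn_char_def)
  have 2: "cube_avg A (\<lambda>a. \<Prod>i\<in>insert k A. 1 + \<theta> i * sgn_char i (insert k a)) = (1 + \<theta> k) * cube_avg A (\<lambda>a. \<Prod>i\<in>A. 1 + \<theta> i * sgn_char i a)"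
    unfolding cube_avg_cmult [symmetric]
    using insert.hyps by (intro cube_avg_cong) (auto simp: sgn_char_def intro!: prod.cong)
  show ?case
    by (simp only: cube_avg_insert [OF insert.hyps] 1 2 insert.IH) simp
qed

text \<open>The mean of the sign of \<open>i\<close> under the density proportional to
  \<open>f\<close>. If \<open>f\<close> has average 0, division by zero makes it 0, which suits
  \<open>bias_split\<close>.\<close>

definition bias :: "'a set \<Rightarrow> ('a set \<Rightarrow> real) \<Rightarrow> 'a \<Rightarrow> real" where
  "bias A f i = cube_avg A (\<lambda>a. f a * sgn_char i a) / cube_avg A f"

lemma divide_divide_cancel_half: "(x / 2) / (y / 2) = x / (y :: real)"
  by (cases "y = 0") (auto simp: field_simps)

text \<open>Under the density proportional to \<open>f\<close>, the element \<open>i\<close> is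
  absent with probability (1 - bias) / 2 and present with probability (1 + bias) / 2. If the average
  is 0, nonnegativity forces both halves to be 0.\<close>

lemma bias_split:
  fixes f :: "'a set \<Rightarrow> real"
  assumes "finite A" "i \<notin> A" and f: "\<forall>a\<subseteq>insert i A. 0 \<le> f a"
  shows "cube_avg A f = cube_avg (insert i A) f * (1 - bias (insert i A) f i)"
    and "cube_avg A (\<lambda>a. f (insert i a)) = cube_avg (insert i A) f * (1 + bias (insert i A) f i)"
    and "\<bar>bias (insert i A) f i\<bar> \<le> 1"
proof -
  define F0 F1 where "F0 = cube_avg A f" and "F1 = cube_avg A (\<lambda>a. f (insert i a))"
  have m: "cube_avg (insert i A) f = (F0 + F1) / 2"
    using assms by (simp add: cube_avg_insert F0_def F1_def)
  have "cube_avg A (\<lambda>a. f a * sgn_char i a) = - F0"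
    unfolding F0_def cube_avg_cmult[of _ "-1", simplified, symmetric]
    using assms by (intro cube_avg_cong) (auto simp: sgn_char_def)
  then have c: "cube_avg (insert i A) (\<lambda>a. f a * sgn_char i a) = (F1 - F0) / 2"
    using assms by (simp add: cube_avg_insert F1_def sgn_char_def)
  have b: "bias (insert i A) f i = (F1 - F0) / (F0 + F1)"
    unfolding bias_def m c by (rule divide_divide_cancel_half)
  have nn: "0 \<le> F0" "0 \<le> F1"
    unfolding F0_def F1_def using f by (intro cube_avg_nonneg; blast)+
  have "F0 = (F0 + F1) / 2 * (1 - (F1 - F0) / (F0 + F1)) \<and>
      F1 = (F0 + F1) / 2 * (1 + (F1 - F0) / (F0 + F1)) \<and> \<bar>(F1 - F0) / (F0 + F1)\<bar> \<le> 1"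
  proof (cases "F0 + F1 = 0")
    case True
    with nn show ?thesis by simp
  next
    case False
    with nn show ?thesis by (auto simp: field_simps abs_le_iff)
  qed
  then show "cube_avg A f = cube_avg (insert i A) f * (1 - bias (insert i A) f i)"
    and "cube_avg A (\<lambda>a. f (insert i a)) = cube_avg (insert i A) f * (1 + bias (insert i A) f i)"
    and "\<bar>bias (insert i A) f i\<bar> \<le> 1"
    unfolding m b F0_def[symmetric] F1_def[symmetric] by blast+
qed

text \<open>Gibbs' inequality: the density \<open>f / m\<close>, whose entropy relative to the
  uniform one is at most \<open>- ln m\<close> because \<open>f\<close> is bounded by 1, is tested
  against a Riesz product tilted along the biases of \<open>f\<close>. The tangent bound
  \<open>ln z \<le> z - 1\<close> does the work of entropy.\<close>

lemma bias_level_one: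
  fixes f :: "'a set \<Rightarrow> real"
  assumes A: "finite A" and f: "\<And>a. a \<subseteq> A \<Longrightarrow> 0 \<le> f a \<and> f a \<le> 1"
    and pos: "0 < cube_avg A f"
  shows "(\<Sum>i\<in>A. (bias A f i)\<^sup>2) \<le> - 8 * ln (cube_avg A f)"
proof -
  define m where "m = cube_avg A f"
  define q where "q = bias A f"
  \<comment> \<open>A tilt by \<open>\<theta> * q i\<close> gains
    \<open>\<theta> - 2 * \<theta>^2\<close> times the squared bias, which is largest, namely 1/8,
    at \<theta> = 1/4. This choice also keeps each perturbation within the range 1/2 of the
    logarithm bound.\<close>
  define X where "X a = (\<Prod>i\<in>A. 1 + q i / 4 * sgn_char i a)" for a
  have m: "0 < m" using pos by (simp add: m_def)
  have q: "\<bar>q i\<bar> \<le> 1" if "i \<in> A" for i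
    using bias_split(3)[of "A - {i}" i f] that A f by (auto simp: q_def insert_absorb)
  have q': "\<bar>q i / 4 * sgn_char i a\<bar> \<le> 1/2" if "i \<in> A" for i a
    using q[OF that] by (auto simp: sgn_char_def)
  have Xpos: "0 < X a" for a
    unfolding X_def
  proof (rule prod_pos)
    fix i assume "i \<in> A"
    then show "0 < 1 + q i / 4 * sgn_char i a" using q'[of i a] by linarith
  qed
  have lower: "(\<Sum>i\<in>A. q i / 4 * sgn_char i a - (q i)\<^sup>2 / 8) \<le> m * X a - 1 - ln m" for a
  proof -
    have "(\<Sum>i\<in>A. q i / 4 * sgn_char i a - (q i)\<^sup>2 / 8) \<le> (\<Sum>i\<in>A. ln (1 + q i / 4 * sgn_char i a))"
    proof (rule sum_mono)
      fix i assume "i \<in> A"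
      from abs_ln_one_plus_x_minus_x_bound[OF q'[OF this, of a]]
      have "q i / 4 * sgn_char i a - 2 * (q i / 4 * sgn_char i a)\<^sup>2 \<le> ln (1 + q i / 4 * sgn_char i a)"
        by linarith
      then
      show "q i / 4 * sgn_char i a - (q i)\<^sup>2 / 8 \<le> ln (1 + q i / 4 * sgn_char i a)"
        by (auto simp: power_mult_distrib power_divide sgn_char_def split: if_splits)
    qed
    also have "\<dots> = ln (X a)"
    proof -
      have "1 + q i / 4 * sgn_char i a \<noteq> 0" if "i \<in> A" for i
        using q'[OF that, of a] by linarith
      then show ?thesis unfolding X_def by (intro ln_prod[symmetric] A)
    qed
    also have "\<dots> \<le> m * X a - 1 - ln m"
      using ln_le_minus_one[of "m * X a"] m Xpos[of a] by (simp add: ln_mult)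
    finally show ?thesis .
  qed
  have "cube_avg A (\<lambda>a. f a * (\<Sum>i\<in>A. q i / 4 * sgn_char i a - (q i)\<^sup>2 / 8))
      \<le> cube_avg A (\<lambda>a. m * X a + f a * (- 1 - ln m))"
  proof (rule cube_avg_mono)
    fix a assume a: "a \<subseteq> A"
    have "f a * (\<Sum>i\<in>A. q i / 4 * sgn_char i a - (q i)\<^sup>2 / 8) \<le> f a * (m * X a - 1 - ln m)"
      using f[OF a] lower by (intro mult_left_mono) auto
    also have "\<dots> = f a * (m * X a) + f a * (- 1 - ln m)" by (simp add: algebra_simps)
    \<comment> \<open>The bound by 1 on \<open>f\<close> enters here: it frees \<open>X\<close> of
      the weight \<open>f a\<close>, so that the average of \<open>X\<close> is 1.\<close>
    also have "f a * (m * X a) \<le> 1 * (m * X a)"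
      using f[OF a] m Xpos[of a] by (intro mult_right_mono) auto
    finally show "f a * (\<Sum>i\<in>A. q i / 4 * sgn_char i a - (q i)\<^sup>2 / 8) \<le> m * X a + f a * (- 1 - ln m)"
      by simp
  qed
  also have "\<dots> = m * 1 + m * (-1 - ln m)"
    unfolding cube_avg_add cube_avg_cmult cube_avg_cmult_right m_def[symmetric]
    using cube_avg_riesz[OF A, of "\<lambda>i. q i / 4"] by (simp add: X_def)
  also have "\<dots> = - m * ln m" by (simp add: algebra_simps)
  also have "cube_avg A (\<lambda>a. f a * (\<Sum>i\<in>A. q i / 4 * sgn_char i a - (q i)\<^sup>2 / 8))
      = (\<Sum>i\<in>A. cube_avg A (\<lambda>a. q i / 4 * (f a * sgn_char i a) + f a * (- (q i)\<^sup>2 / 8)))"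
    unfolding cube_avg_sum[symmetric] by (intro cube_avg_cong) (simp add: sum_distrib_left algebra_simps)
  \<comment> \<open>The average of \<open>f\<close> times the sign of \<open>i\<close> is
    \<open>m * q i\<close>, so coordinate \<open>i\<close> contributes \<open>m\<close> times
    \<open>(q i)^2 / 4 - (q i)^2 / 8\<close>.\<close>
  also have "\<dots> = (\<Sum>i\<in>A. m * ((q i)\<^sup>2 / 8))"
    unfolding cube_avg_add cube_avg_cmult cube_avg_cmult_right
    using m by (intro sum.cong refl) (simp add: q_def bias_def m_def field_simps power2_eq_square)
  also have "\<dots> = m * ((\<Sum>i\<in>A. (q i)\<^sup>2) / 8)"
    by (simp add: sum_distrib_left sum_divide_distrib)
  finally have "m * ((\<Sum>i\<in>A. (q i)\<^sup>2) / 8) \<le> m * - ln m" by simp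
  then have "(\<Sum>i\<in>A. (q i)\<^sup>2) / 8 \<le> - ln m" using m by (rule mult_left_le_imp_le)
  then show ?thesis by (simp add: q_def m_def)
qed

text \<open>\<open>p\<close> and \<open>q\<close> stand for the biases of one element in the two
  factors. Up to a common factor, \<open>1 - p\<close> and \<open>1 - q\<close> are the masses of
  two rectangles of disjoint pairs, and \<open>(1 + p) * (1 + q)\<close> is the mass of the pairs
  sharing the element. To first order the sides differ by \<open>t\<close> plus a multiple of
  \<open>p + q\<close>; the slack \<open>t\<close> absorbs the linear term at the price of squared
  biases over \<open>t\<close>.\<close>

lemma correlation_poly:
  fixes t p q :: real
  assumes "0 < t" "t \<le> 1" "\<bar>p\<bar> \<le> 1" "\<bar>q\<bar> \<le> 1"
  shows "(1 - t) / 2 * ((1 - q) + (1 - p)) - 4 / t * (p\<^sup>2 * (1 - q) + q\<^sup>2 * (1 - p)) \<le> (1 + p) * (1 + q)"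
proof -
  define R where "R = p\<^sup>2 * (1 - q) + q\<^sup>2 * (1 - p)"
  define S where "S = p\<^sup>2 + q\<^sup>2"
  define z where "z = p * q"
  define s where "s = p + q"
  have Req: "R = S - z * s"
    by (simp add: R_def S_def z_def s_def algebra_simps power2_eq_square)
  have S: "0 \<le> S" by (simp add: S_def)
  have z: "\<bar>z\<bar> \<le> S / 2"
    using sum_squares_bound[of p q] sum_squares_bound[of "-p" q] by (simp add: S_def z_def abs_if)
  have s: "s\<^sup>2 \<le> 2 * S"
    using sum_squares_bound[of p q] by (simp add: S_def s_def power2_sum)
  \<comment> \<open>The claim multiplied by \<open>t\<close>, in terms of \<open>s = p + q\<close>
    and \<open>z = p * q\<close>.\<close>
  have "0 \<le> t\<^sup>2 + (3 - t) / 2 * t * s + t * z + 4 * R"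
  \<comment> \<open>If \<open>z\<close> and \<open>s\<close> are both positive, every term is
    nonnegative. Otherwise \<open>R\<close> is at least \<open>S / 2\<close>, and
    \<open>4 * R\<close> pays for the negative terms.\<close>
  proof (cases "z \<le> 0 \<or> s \<le> 0")
    case True
    have R: "S / 2 \<le> R"
    proof (cases "z \<le> 0")
      case True
      then have "\<bar>s\<bar> \<le> 1" using assms by (auto simp: z_def s_def mult_le_0_iff)
      then have "\<bar>z * s\<bar> \<le> \<bar>z\<bar> * 1"
        unfolding abs_mult by (intro mult_left_mono) auto
      then show ?thesis using z Req by linarith
    next
      case False
      with \<open>z \<le> 0 \<or> s \<le> 0\<close> have "z * s \<le> 0" by (intro mult_nonneg_nonpos) auto
      then show ?thesis using S Req by linarith
    qed
    have "\<bar>t * z\<bar> \<le> 1 * \<bar>z\<bar>"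
      unfolding abs_mult using assms by (intro mult_right_mono) auto
    then have 1: "- (t * z) \<le> S / 2" using z by linarith
    have "\<bar>(3 - t) / 2 * t * s\<bar> \<le> 3 / 2 * t * \<bar>s\<bar>"
      using assms by (simp add: abs_mult mult_right_mono)
    \<comment> \<open>AM-GM uses up the term \<open>t^2\<close>. The remaining
      \<open>9 / 8 * S\<close>, together with the \<open>S / 2\<close> from \<open>t * z\<close>,
      stays below \<open>4 * R\<close>, which is at least \<open>2 * S\<close>.\<close>
    also have "\<dots> \<le> t\<^sup>2 + 9 / 16 * \<bar>s\<bar>\<^sup>2"
      using zero_le_power2[of "t - 3 / 4 * \<bar>s\<bar>"]
      by (simp add: power2_diff power_mult_distrib power_divide)
    finally have 2: "- ((3 - t) / 2 * t * s) \<le> t\<^sup>2 + 9 / 8 * S" using s by simp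
    define x y w where "x = (3 - t) / 2 * t * s" and "y = t * z" and "w = t\<^sup>2"
    show ?thesis using 1 2 R S unfolding x_def[symmetric] y_def[symmetric] w_def[symmetric]
      by linarith
  next
    case False
    have "0 \<le> R" unfolding R_def using assms by simp
    moreover have "0 \<le> (3 - t) / 2 * t * s" "0 \<le> t * z" using False assms by simp_all
    ultimately show ?thesis by simp
  qed
  then have "0 \<le> (t\<^sup>2 + (3 - t) / 2 * t * s + t * z + 4 * R) / t"
    using assms by simp
  also have "\<dots> = t + (3 - t) / 2 * s + z + 4 / t * R"
    using assms by (simp add: add_divide_distrib power2_eq_square)
  also have "t + (3 - t) / 2 * s + z = (1 + p) * (1 + q) - (1 - t) / 2 * ((1 - q) + (1 - p))"
    by (simp add: s_def z_def field_simps)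
  finally show ?thesis unfolding R_def[symmetric] by linarith
qed

subsection \<open>Nonnegative rank of shifted unique disjointness\<close>

text \<open>An unnormalized expectation over random disjoint pairs: \<open>A\<close> is uniform,
  then \<open>a\<close> and \<open>b\<close> are independent uniform subsets of \<open>A\<close> and
  of its complement. The total weight is \<open>2 ^ card U\<close>.\<close>

definition disj_sum :: "'a set \<Rightarrow> ('a set \<Rightarrow> 'a set \<Rightarrow> real) \<Rightarrow> real" where
  "disj_sum U h = (\<Sum>A\<in>Pow U. cube_avg A (\<lambda>a. cube_avg (U - A) (\<lambda>b. h a b)))"

text \<open>The analogue for pairs meeting exactly in \<open>i\<close>: the remaining elements are
  distributed as in \<open>disj_sum\<close> on \<open>U - {i}\<close>. Each \<open>i\<close> has
  total weight \<open>2 ^ (card U - 1)\<close>.\<close>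

definition meet_sum :: "'a set \<Rightarrow> ('a set \<Rightarrow> 'a set \<Rightarrow> real) \<Rightarrow> real" where
  "meet_sum U h = (\<Sum>i\<in>U. \<Sum>A\<in>Pow (U - {i}).
     cube_avg A (\<lambda>a. cube_avg (U - {i} - A) (\<lambda>b. h (insert i a) (insert i b))))"

lemma disj_sum_sum: "disj_sum U (\<lambda>a b. \<Sum>l\<in>I. h l a b) = (\<Sum>l\<in>I. disj_sum U (h l))"
  unfolding disj_sum_def cube_avg_sum by (rule sum.swap)

lemma meet_sum_sum: "meet_sum U (\<lambda>a b. \<Sum>l\<in>I. h l a b) = (\<Sum>l\<in>I. meet_sum U (h l))"
  unfolding meet_sum_def cube_avg_sum by (simp add: sum.swap[of _ I])

lemma disj_sum_cmult: "disj_sum U (\<lambda>a b. c * h a b) = c * disj_sum U h"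
  unfolding disj_sum_def cube_avg_cmult by (simp add: sum_distrib_left)

lemma meet_sum_cmult: "meet_sum U (\<lambda>a b. c * h a b) = c * meet_sum U h"
  unfolding meet_sum_def cube_avg_cmult by (simp add: sum_distrib_left)

lemma disj_sum_const:
  fixes c :: real
  assumes "finite U" "\<And>a b. a \<subseteq> U \<Longrightarrow> b \<subseteq> U \<Longrightarrow> a \<inter> b = {} \<Longrightarrow> h a b = c"
  shows "disj_sum U h = 2 ^ card U * c"
proof -
  have "cube_avg A (\<lambda>a. cube_avg (U - A) (h a)) = cube_avg A (\<lambda>a. cube_avg (U - A) (\<lambda>b. c))"
    if "A \<subseteq> U" for A
    using that by (intro cube_avg_cong assms(2)) auto
  moreover have "finite A" if "A \<subseteq> U" for A using that assms(1) finite_subset by blast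
  ultimately have "disj_sum U h = (\<Sum>A\<in>Pow U. c)"
    unfolding disj_sum_def using assms(1) by (intro sum.cong) auto
  then show ?thesis using assms(1) by (simp add: card_Pow)
qed

lemma meet_sum_const:
  fixes c :: real
  assumes U: "finite U"
    and h: "\<And>i a b. i \<in> U \<Longrightarrow> a \<subseteq> U \<Longrightarrow> b \<subseteq> U \<Longrightarrow> a \<inter> b = {i} \<Longrightarrow> h a b = c"
  shows "meet_sum U h = real (card U) * 2 ^ card U * c / 2"
proof -
  have *: "cube_avg A (\<lambda>a. cube_avg (U - {i} - A) (\<lambda>b. h (insert i a) (insert i b))) = c"
    if "i \<in> U" "A \<subseteq> U - {i}" for i A
  proof -
    have "finite A" using that U finite_subset by blast
    moreover have "cube_avg A (\<lambda>a. cube_avg (U - {i} - A) (\<lambda>b. h (insert i a) (insert i b)))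
      = cube_avg A (\<lambda>a. cube_avg (U - {i} - A) (\<lambda>b. c))"
      using that by (intro cube_avg_cong h[of i]) auto
    ultimately show ?thesis using U by simp
  qed
  have "meet_sum U h = (\<Sum>i\<in>U. 2 ^ card U * c / 2)"
    unfolding meet_sum_def
  proof (rule sum.cong)
    fix i assume i: "i \<in> U"
    have "(\<Sum>A\<in>Pow (U - {i}). cube_avg A (\<lambda>a. cube_avg (U - {i} - A) (\<lambda>b. h (insert i a) (insert i b))))
       = (\<Sum>A\<in>Pow (U - {i}). c)"
      using * i by (intro sum.cong) auto
    also have "\<dots> = 2 ^ card (U - {i}) * c" using U by (simp add: card_Pow)
    also have "\<dots> = 2 ^ card U * c / 2"
      using card.remove[OF U i] by simp
    finally show "(\<Sum>A\<in>Pow (U - {i}). cube_avg A (\<lambda>a. cube_avg (U - {i} - A) (\<lambda>b. h (insert i a) (insert i b))))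
       = 2 ^ card U * c / 2" .
  qed simp
  then show ?thesis by simp
qed

text \<open>The concave function \<open>- (m * ln m)\<close> lies below its tangent at
  \<open>m = exp (- s)\<close>, from which a term \<open>- m\<close> is dropped. This trades the
  factor \<open>- ln m\<close> for the constant \<open>s\<close>, with an additive error relevant
  only for tiny masses.\<close>

lemma neg_mult_ln_le:
  fixes m s :: real
  assumes "0 < m"
  shows "- (m * ln m) \<le> s * m + exp (- s)"
proof -
  have "ln (exp (- s) / m) \<le> exp (- s) / m - 1"
    using assms by (intro ln_le_minus_one) auto
  then have "m * (- s - ln m) \<le> m * (exp (- s) / m - 1)"
    using assms by (intro mult_left_mono) (auto simp: ln_div)
  then show ?thesis using assms by (simp add: algebra_simps)
qed

text \<open>For each \<open>i\<close>, the partitions given by \<open>A\<close> and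
  \<open>insert i A\<close> are compared with the rectangle in which \<open>i\<close> lies on both
  sides, by \<open>correlation_poly\<close>. The squared biases are summed by the level-one
  inequality; 32 is the factor 4 of the former times the factor 8 of the latter.\<close>

lemma disj_sum_le_meet_sum:
  fixes f g :: "'a set \<Rightarrow> real" and s t :: real
  assumes U: "finite U"
    and f: "\<And>a. a \<subseteq> U \<Longrightarrow> 0 \<le> f a \<and> f a \<le> 1"
    and g: "\<And>b. b \<subseteq> U \<Longrightarrow> 0 \<le> g b \<and> g b \<le> 1"
    and t: "0 < t" "t \<le> 1"
  shows "((1 - t) * card U / 2 - 32 * s / t) * disj_sum U (\<lambda>a b. f a * g b)
      - 32 / t * exp (- s) * 2 ^ card U \<le> meet_sum U (\<lambda>a b. f a * g b)"
proof -
  define m where "m A = cube_avg A f * cube_avg (U - A) g" for A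
  \<comment> \<open>The squared bias of \<open>i\<close> in the factor on whose side of the
    partition \<open>i\<close> lies, weighted by the mass of the rectangle.\<close>
  define e where "e i A = (if i \<in> A then (bias A f i)\<^sup>2 else (bias (U - A) g i)\<^sup>2) * m A" for i A
  have disj: "disj_sum U (\<lambda>a b. f a * g b) = (\<Sum>A\<in>Pow U. m A)"
    by (simp add: disj_sum_def m_def cube_avg_cmult cube_avg_cmult_right)
  have avg: "0 \<le> cube_avg A f" "cube_avg A f \<le> 1" "0 \<le> cube_avg A g" "cube_avg A g \<le> 1"
    if "A \<subseteq> U" for A
  proof -
    have "finite A" using that U finite_subset by blast
    then have "cube_avg A (\<lambda>_. 1) = 1" by simp
    moreover have "cube_avg A f \<le> cube_avg A (\<lambda>_. 1)" "cube_avg A g \<le> cube_avg A (\<lambda>_. 1)"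
      using that f g by (auto intro!: cube_avg_mono)
    ultimately show "0 \<le> cube_avg A f" "cube_avg A f \<le> 1" "0 \<le> cube_avg A g" "cube_avg A g \<le> 1"
      using that f g by (auto intro!: cube_avg_nonneg)
  qed
  have point: "(1 - t) / 2 * (m A + m (insert i A)) - 4 / t * (e i A + e i (insert i A))
      \<le> cube_avg A (\<lambda>a. f (insert i a)) * cube_avg (U - {i} - A) (\<lambda>b. g (insert i b))"
    if i: "i \<in> U" and A: "A \<subseteq> U - {i}" for i A
  proof -
    define B where "B = U - {i} - A"
    have sets: "U - A = insert i B" "U - insert i A = B" "i \<notin> A" "i \<notin> B" "finite A" "finite B"
      using i A U finite_subset by (auto simp: B_def)
    have fA: "\<forall>a\<subseteq>insert i A. 0 \<le> f a" using i A f by auto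
    have gB: "\<forall>b\<subseteq>insert i B. 0 \<le> g b"
    proof (intro allI impI)
      fix b assume "b \<subseteq> insert i B"
      then have "b \<subseteq> U" using i by (auto simp: B_def)
      then show "0 \<le> g b" using g by blast
    qed
    define p q where "p = bias (insert i A) f i" and "q = bias (insert i B) g i"
    \<comment> \<open>Here \<open>i\<close> is allowed on both sides. Excluding it from the first
      side gives \<open>m A\<close>, excluding it from the second gives
      \<open>m (insert i A)\<close>, and forcing it into both gives the meeting term, so all three
      are multiples of \<open>x * y\<close>.\<close>
    define x y where "x = cube_avg (insert i A) f" and "y = cube_avg (insert i B) g"
    note sf = bias_split[OF sets(5,3) fA, folded p_def x_def]
    note sg = bias_split[OF sets(6,4) gB, folded q_def y_def]
    have xy: "0 \<le> x * y"
      unfolding x_def y_def using i A by (intro mult_nonneg_nonneg avg) (auto simp: B_def)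
    have m: "m A = x * y * (1 - p)" "m (insert i A) = x * y * (1 - q)"
      using sf(1) sg(1) by (simp_all add: m_def sets x_def[symmetric] y_def[symmetric])
    have e: "e i A = x * y * (q\<^sup>2 * (1 - p))" "e i (insert i A) = x * y * (p\<^sup>2 * (1 - q))"
      using m by (simp_all add: e_def sets p_def q_def)
    have ring: "x * y * (r * ((1 - q) + (1 - p)) - k * (p\<^sup>2 * (1 - q) + q\<^sup>2 * (1 - p)))
        = r * (x * y * (1 - p) + x * y * (1 - q)) - k * (x * y * (q\<^sup>2 * (1 - p)) + x * y * (p\<^sup>2 * (1 - q)))"
      for r k by (simp add: algebra_simps)
    have ring': "x * y * ((1 + p) * (1 + q)) = x * (1 + p) * (y * (1 + q))" by simp
    show ?thesis
      using mult_left_mono[OF correlation_poly[OF t sf(3) sg(3)] xy]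
      unfolding m e sf(2) sg(2) B_def[symmetric] ring ring' .
  qed
  have meet: "meet_sum U (\<lambda>a b. f a * g b) = (\<Sum>i\<in>U. \<Sum>A\<in>Pow (U - {i}).
      cube_avg A (\<lambda>a. f (insert i a)) * cube_avg (U - {i} - A) (\<lambda>b. g (insert i b)))"
    by (simp add: meet_sum_def cube_avg_cmult cube_avg_cmult_right)
  \<comment> \<open>For fixed \<open>i\<close>, the sets \<open>A\<close> avoiding \<open>i\<close>
    and their partners \<open>insert i A\<close> exhaust \<open>Pow U\<close>, so each partition is
    counted once per element.\<close>
  have "(\<Sum>i\<in>U. (1 - t) / 2 * (\<Sum>A\<in>Pow U. m A) - 4 / t * (\<Sum>A\<in>Pow U. e i A))
      \<le> meet_sum U (\<lambda>a b. f a * g b)"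
    unfolding meet
  proof (rule sum_mono)
    fix i assume i: "i \<in> U"
    have split: "(\<Sum>A\<in>Pow U. F A) = (\<Sum>A\<in>Pow (U - {i}). F A + F (insert i A))" for F :: "'a set \<Rightarrow> real"
      using sum_Pow_insert[of "U - {i}" i F] U i by (simp add: insert_absorb[OF i])
    have "(1 - t) / 2 * (\<Sum>A\<in>Pow U. m A) - 4 / t * (\<Sum>A\<in>Pow U. e i A)
      = (\<Sum>A\<in>Pow (U - {i}). (1 - t) / 2 * (m A + m (insert i A)) - 4 / t * (e i A + e i (insert i A)))"
      by (simp only: split sum_distrib_left sum_subtractf)
    also have "\<dots> \<le> (\<Sum>A\<in>Pow (U - {i}). cube_avg A (\<lambda>a. f (insert i a))
        * cube_avg (U - {i} - A) (\<lambda>b. g (insert i b)))"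
      using i by (intro sum_mono point) auto
    finally show "(1 - t) / 2 * (\<Sum>A\<in>Pow U. m A) - 4 / t * (\<Sum>A\<in>Pow U. e i A) \<le> \<dots>" .
  qed
  moreover have "(\<Sum>i\<in>U. r * M - k * (\<Sum>A\<in>Pow U. e i A))
      = real (card U) * (r * M) - k * (\<Sum>A\<in>Pow U. \<Sum>i\<in>U. e i A)" for r M k
  proof -
    have "(\<Sum>A\<in>Pow U. \<Sum>i\<in>U. e i A) = (\<Sum>i\<in>U. \<Sum>A\<in>Pow U. e i A)" by (rule sum.swap)
    then show ?thesis by (simp add: sum_subtractf sum_distrib_left)
  qed
  ultimately have 1: "real (card U) * ((1 - t) / 2 * (\<Sum>A\<in>Pow U. m A))
      - 4 / t * (\<Sum>A\<in>Pow U. \<Sum>i\<in>U. e i A) \<le> meet_sum U (\<lambda>a b. f a * g b)"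
    by (simp only:)
  \<comment> \<open>If \<open>m A\<close> is 0, all errors vanish with it. Otherwise the level-one
    inequality applies on both sides of the partition, and the two logarithms add up to
    \<open>ln (m A)\<close>.\<close>
  have "(\<Sum>i\<in>U. e i A) \<le> 8 * (s * m A + exp (- s))" if A: "A \<in> Pow U" for A
  proof (cases "m A = 0")
    case True
    then have "(\<Sum>i\<in>U. e i A) = 0" by (simp add: e_def)
    then show ?thesis using True by simp
  next
    case False
    have A: "A \<subseteq> U" "U - A \<subseteq> U" "finite A" using A U finite_subset by auto
    have "cube_avg A f \<noteq> 0" "cube_avg (U - A) g \<noteq> 0"
      using False by (auto simp: m_def)
    then have pos: "0 < cube_avg A f" "0 < cube_avg (U - A) g"
      using avg(1)[OF A(1)] avg(3)[OF A(2)] by simp_all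
    then have m: "0 < m A" by (simp add: m_def)
    have l: "(\<Sum>i\<in>A. (bias A f i)\<^sup>2) \<le> - 8 * ln (cube_avg A f)"
      using A f pos by (intro bias_level_one) auto
    have l': "(\<Sum>i\<in>U - A. (bias (U - A) g i)\<^sup>2) \<le> - 8 * ln (cube_avg (U - A) g)"
      using U g pos by (intro bias_level_one) auto
    have "(\<Sum>i\<in>U. e i A) = (\<Sum>i\<in>U - A. e i A) + (\<Sum>i\<in>A. e i A)"
      by (rule sum.subset_diff[OF A(1) U])
    also have "\<dots> = m A * ((\<Sum>i\<in>A. (bias A f i)\<^sup>2) + (\<Sum>i\<in>U - A. (bias (U - A) g i)\<^sup>2))"
      by (simp add: e_def sum_distrib_left distrib_left mult.commute)
    also have "\<dots> \<le> m A * (- 8 * ln (cube_avg A f) + - 8 * ln (cube_avg (U - A) g))"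
      using l l' m by (intro mult_left_mono add_mono) auto
    also have "\<dots> = 8 * - (m A * ln (m A))"
      using pos by (simp add: m_def ln_mult algebra_simps)
    also have "\<dots> \<le> 8 * (s * m A + exp (- s))"
      using neg_mult_ln_le[OF m, of s] by simp
    finally show ?thesis .
  qed
  then have "(\<Sum>A\<in>Pow U. \<Sum>i\<in>U. e i A) \<le> (\<Sum>A\<in>Pow U. 8 * (s * m A + exp (- s)))"
    by (rule sum_mono)
  also have "\<dots> = 8 * (s * (\<Sum>A\<in>Pow U. m A) + 2 ^ card U * exp (- s))"
  proof -
    have "(\<Sum>A\<in>Pow U. exp (- s)) = 2 ^ card U * exp (- s)" using U by (simp add: card_Pow)
    then show ?thesis by (simp only: sum_distrib_left[symmetric] sum.distrib)
  qed
  finally have 2: "4 / t * (\<Sum>A\<in>Pow U. \<Sum>i\<in>U. e i A)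
      \<le> 4 / t * (8 * (s * (\<Sum>A\<in>Pow U. m A) + 2 ^ card U * exp (- s)))"
    using t by (intro mult_left_mono) auto
  have ring: "4 / t * (8 * (s * M + N * x)) = 32 * s / t * M + 32 / t * x * N" for M N x :: real
    by (simp add: algebra_simps add_divide_distrib)
  have "real (card U) * ((1 - t) / 2 * (\<Sum>A\<in>Pow U. m A))
      - (32 * s / t * (\<Sum>A\<in>Pow U. m A) + 32 / t * exp (- s) * 2 ^ card U) \<le> meet_sum U (\<lambda>a b. f a * g b)"
    using 1 2[unfolded ring] by linarith
  moreover have "c * (r / 2 * M) - (k * M + z) = (r * c / 2 - k) * M - z" for c r k M z :: real
    by (simp add: algebra_simps)
  ultimately show ?thesis unfolding disj by (simp only:)
qed

section \<open>From rank-one terms to the rank bound\<close>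

text \<open>A rank-one matrix determines its factors only up to a scalar: moving the maximum of
  \<open>u\<close> over to \<open>v\<close> writes the product as \<open>L\<close> times a product
  of functions with values in [0, 1].\<close>

lemma disj_sum_le_meet_sum_scaled:
  fixes u v :: "'a set \<Rightarrow> real" and L s t :: real
  assumes U: "finite U"
    and u: "\<And>a. a \<subseteq> U \<Longrightarrow> 0 \<le> u a" and v: "\<And>b. b \<subseteq> U \<Longrightarrow> 0 \<le> v b"
    and L: "\<And>a b. a \<subseteq> U \<Longrightarrow> b \<subseteq> U \<Longrightarrow> u a * v b \<le> L" "0 < L"
    and t: "0 < t" "t \<le> 1"
  shows "((1 - t) * card U / 2 - 32 * s / t) * disj_sum U (\<lambda>a b. u a * v b)
      - 32 / t * exp (- s) * 2 ^ card U * L \<le> meet_sum U (\<lambda>a b. u a * v b)"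
proof -
  define c where "c = Max (u ` Pow U)"
  have cu: "u a \<le> c" if "a \<subseteq> U" for a
    unfolding c_def using that U by (intro Max_ge) auto
  have "c \<in> u ` Pow U" unfolding c_def using U by (intro Max_in) auto
  then obtain a0 where a0: "a0 \<subseteq> U" "c = u a0" by auto
  \<comment> \<open>The divisor is the maximum of \<open>u\<close>, unless that is 0. Then
    \<open>u\<close> vanishes, and any positive \<open>d\<close> with \<open>d * v b \<le> L\<close>
    will do.\<close>
  obtain d where d: "0 < d" "\<And>a. a \<subseteq> U \<Longrightarrow> u a \<le> d" "\<And>b. b \<subseteq> U \<Longrightarrow> d * v b \<le> L"
  proof (cases "c = 0")
    case False
    then have c: "0 < c" using u[OF a0(1)] a0(2) by simp
    show ?thesis
    proof (rule that[OF c cu])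
      show "c * v b \<le> L" if "b \<subseteq> U" for b using L(1)[OF a0(1) that] a0(2) by simp
    qed
  next
    case True
    define z where "z = Max (v ` Pow U)"
    have z: "v b \<le> z" if "b \<subseteq> U" for b
      unfolding z_def using that U by (intro Max_ge) auto
    have z0: "0 \<le> z" using z[of "{}"] v[of "{}"] by simp
    have "L / (1 + z) * v b \<le> L" if "b \<subseteq> U" for b
    proof -
      have "L / (1 + z) * v b \<le> L / (1 + z) * (1 + z)"
        using z[OF that] z0 L(2) by (intro mult_left_mono) auto
      then show ?thesis using z0 by simp
    qed
    moreover have "u a \<le> L / (1 + z)" if "a \<subseteq> U" for a
    proof -
      have "u a \<le> 0" using cu[OF that] True by simp
      also have "0 \<le> L / (1 + z)" using z0 L(2) by simp
      finally show ?thesis .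
    qed
    moreover have "0 < L / (1 + z)" using z0 L(2) by simp
    ultimately show ?thesis using that by blast
  qed
  define f g where "f a = u a / d" and "g b = d * v b / L" for a b
  have "((1 - t) * card U / 2 - 32 * s / t) * disj_sum U (\<lambda>a b. f a * g b)
      - 32 / t * exp (- s) * 2 ^ card U \<le> meet_sum U (\<lambda>a b. f a * g b)"
  proof (rule disj_sum_le_meet_sum[OF U _ _ t])
    show "0 \<le> f a \<and> f a \<le> 1" if "a \<subseteq> U" for a
      using that u d(1,2) by (simp add: f_def)
    show "0 \<le> g b \<and> g b \<le> 1" if "b \<subseteq> U" for b
      using that v d(1,3) L(2) by (simp add: g_def)
  qed
  from mult_left_mono[OF this less_imp_le[OF L(2)]]
  have "L * (((1 - t) * card U / 2 - 32 * s / t) * disj_sum U (\<lambda>a b. f a * g b)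
      - 32 / t * exp (- s) * 2 ^ card U) \<le> L * meet_sum U (\<lambda>a b. f a * g b)" .
  moreover have "L * (x * y - z) = x * (L * y) - z * L" for x y z
    by (simp add: algebra_simps)
  ultimately have le: "((1 - t) * card U / 2 - 32 * s / t) * (L * disj_sum U (\<lambda>a b. f a * g b))
      - 32 / t * exp (- s) * 2 ^ card U * L \<le> L * meet_sum U (\<lambda>a b. f a * g b)" by (simp only:)
  have "(\<lambda>a b. u a * v b) = (\<lambda>a b. L * (f a * g b))"
    using d(1) L(2) by (simp add: fun_eq_iff f_def g_def)
  then have "disj_sum U (\<lambda>a b. u a * v b) = L * disj_sum U (\<lambda>a b. f a * g b)"
    "meet_sum U (\<lambda>a b. u a * v b) = L * meet_sum U (\<lambda>a b. f a * g b)"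
    using disj_sum_cmult[of U L "\<lambda>a b. f a * g b"] meet_sum_cmult[of U L "\<lambda>a b. f a * g b"]
    by (simp_all only:)
  with le show ?thesis by (simp only:)
qed

text \<open>The comparison of \<open>disj_sum\<close> and \<open>meet_sum\<close> is summed over the
  rank-one terms. Passing to meeting pairs lowers the entries by the fraction
  \<open>1 / \<rho>\<close>, while the main term permits a loss of only
  \<open>2 * t = 1 / (2 * \<rho>)\<close>. The gap \<open>n * N / 4\<close> must be covered by the
  error terms, each of which carries the factor \<open>exp (- s)\<close>.\<close>

lemma shifted_disjointness_rank:
  fixes u v :: "'l \<Rightarrow> 'a set \<Rightarrow> real" and \<rho> L :: real
  assumes U: "finite U" "U \<noteq> {}" and I: "finite I" and \<rho>: "1 \<le> \<rho>" and L: "0 < L"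
    and u: "\<And>l a. l \<in> I \<Longrightarrow> a \<subseteq> U \<Longrightarrow> 0 \<le> u l a"
    and v: "\<And>l b. l \<in> I \<Longrightarrow> b \<subseteq> U \<Longrightarrow> 0 \<le> v l b"
    and le: "\<And>a b. a \<subseteq> U \<Longrightarrow> b \<subseteq> U \<Longrightarrow> (\<Sum>l\<in>I. u l a * v l b) \<le> L"
    and disj: "\<And>a b. a \<subseteq> U \<Longrightarrow> b \<subseteq> U \<Longrightarrow> a \<inter> b = {} \<Longrightarrow> (\<Sum>l\<in>I. u l a * v l b) = \<rho>"
    and meet: "\<And>i a b. i \<in> U \<Longrightarrow> a \<subseteq> U \<Longrightarrow> b \<subseteq> U \<Longrightarrow> a \<inter> b = {i} \<Longrightarrow> (\<Sum>l\<in>I. u l a * v l b) = \<rho> - 1"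
  shows "card U * exp (card U / (1024 * \<rho>\<^sup>2)) \<le> 512 * \<rho> * L * card I"
proof -
  define n where "n = real (card U)"
  define N where "N = (2::real) ^ card U"
  \<comment> \<open>With this \<open>t\<close>, the parameter \<open>s = t^2 * n / 64\<close> makes
    \<open>32 * s / t\<close> equal to \<open>t * n / 2\<close>, so the two losses in the main term
    agree.\<close>
  define t where "t = 1 / (4 * \<rho>)"
  define s where "s = n / (1024 * \<rho>\<^sup>2)"
  have n: "0 < n" using U by (simp add: n_def card_gt_0_iff)
  have N: "0 < N" by (simp add: N_def)
  have t: "0 < t" "t \<le> 1" using \<rho> by (auto simp: t_def)
  have "((1 - t) * n / 2 - 32 * s / t) * disj_sum U (\<lambda>a b. u l a * v l b)
      - 32 / t * exp (- s) * N * L \<le> meet_sum U (\<lambda>a b. u l a * v l b)" if l: "l \<in> I" for l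
    unfolding n_def N_def
  proof (rule disj_sum_le_meet_sum_scaled)
    fix a b assume ab: "a \<subseteq> U" "b \<subseteq> U"
    have "u l a * v l b \<le> (\<Sum>l\<in>I. u l a * v l b)"
      using ab u v l I by (intro member_le_sum) auto
    also have "\<dots> \<le> L" by (rule le) (use ab in auto)
    finally show "u l a * v l b \<le> L" .
  qed (use U l u v L t in auto)
  then have "(\<Sum>l\<in>I. ((1 - t) * n / 2 - 32 * s / t) * disj_sum U (\<lambda>a b. u l a * v l b)
      - 32 / t * exp (- s) * N * L) \<le> (\<Sum>l\<in>I. meet_sum U (\<lambda>a b. u l a * v l b))"
    by (rule sum_mono)
  then have "((1 - t) * n / 2 - 32 * s / t) * disj_sum U (\<lambda>a b. \<Sum>l\<in>I. u l a * v l b)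
      - card I * (32 / t * exp (- s) * N * L) \<le> meet_sum U (\<lambda>a b. \<Sum>l\<in>I. u l a * v l b)"
    by (simp add: sum_subtractf disj_sum_sum meet_sum_sum sum_distrib_left)
  moreover have "disj_sum U (\<lambda>a b. \<Sum>l\<in>I. u l a * v l b) = N * \<rho>"
    unfolding N_def by (rule disj_sum_const[OF U(1) disj])
  moreover have "meet_sum U (\<lambda>a b. \<Sum>l\<in>I. u l a * v l b) = n * N * (\<rho> - 1) / 2"
    unfolding N_def n_def by (rule meet_sum_const[OF U(1) meet])
  ultimately have "((1 - t) * n / 2 - 32 * s / t) * (N * \<rho>)
      - card I * (32 / t * exp (- s) * N * L) \<le> n * N * (\<rho> - 1) / 2" by simp
  moreover have "32 * s / t = t * n / 2" 
    using \<rho> by (simp add: s_def t_def field_simps power2_eq_square)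
  ultimately have "((1 - t) * n / 2 - t * n / 2) * (N * \<rho>)
      - card I * (32 / t * exp (- s) * N * L) \<le> n * N * (\<rho> - 1) / 2" by simp
  moreover have "((1 - t) * n / 2 - t * n / 2) * (N * \<rho>) = n * N * \<rho> / 2 - n * N / 4"
    using \<rho> by (simp add: t_def field_simps)
  moreover have "n * N * (\<rho> - 1) / 2 = n * N * \<rho> / 2 - n * N / 2" by (simp add: algebra_simps diff_divide_distrib)
  ultimately have "n * N / 4 \<le> card I * (32 / t * exp (- s) * N * L)" by linarith
  \<comment> \<open>The constant is 4 * 32 * 4, the last factor coming from
    \<open>1 / t = 4 * \<rho>\<close>.\<close>
  then have "N * n \<le> N * (512 * \<rho> * L * card I * exp (- s))"
    by (simp add: t_def algebra_simps)
  then have "n \<le> 512 * \<rho> * L * card I * exp (- s)" using N by simp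
  then have "n * exp s \<le> 512 * \<rho> * L * card I * exp (- s) * exp s" by simp
  also have "\<dots> = 512 * \<rho> * L * card I" by (simp add: exp_minus)
  finally show ?thesis by (simp add: n_def s_def)
qed

subsection \<open>Farkas' lemma\<close>

text \<open>Induction on the number of functionals, eliminating one by projection onto its kernel.
  The carrier \<open>W\<close> with \<open>comb s u v\<close> in the role of
  \<open>u + s * v\<close> covers both a solution space of tuples and a full function space.\<close>

lemma farkas:
  fixes comb :: "real \<Rightarrow> 'v \<Rightarrow> 'v \<Rightarrow> 'v" and \<phi> :: "'i \<Rightarrow> 'v \<Rightarrow> real" and \<psi> :: "'v \<Rightarrow> real"
  assumes "finite I"
    and W: "\<And>s u v. u \<in> W \<Longrightarrow> v \<in> W \<Longrightarrow> comb s u v \<in> W"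
    and "\<And>i s u v. i \<in> I \<Longrightarrow> u \<in> W \<Longrightarrow> v \<in> W \<Longrightarrow> \<phi> i (comb s u v) = \<phi> i u + s * \<phi> i v"
    and "\<And>s u v. u \<in> W \<Longrightarrow> v \<in> W \<Longrightarrow> \<psi> (comb s u v) = \<psi> u + s * \<psi> v"
    and "\<And>v. v \<in> W \<Longrightarrow> \<forall>i\<in>I. 0 \<le> \<phi> i v \<Longrightarrow> 0 \<le> \<psi> v"
  shows "\<exists>c. (\<forall>i\<in>I. 0 \<le> c i) \<and> (\<forall>v\<in>W. \<psi> v = (\<Sum>i\<in>I. c i * \<phi> i v))"
  using assms(1,3,4,5)
proof (induction I arbitrary: \<phi> \<psi>)
  case empty
  \<comment> \<open>\<open>comb (-2) v v\<close> plays the role of \<open>- v\<close>.\<close>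
  have "\<psi> v = 0" if "v \<in> W" for v
    using empty(3)[OF that] empty(3)[OF W[OF that that, of "-2"]] empty(2)[OF that that, of "-2"]
    by simp
  then show ?case by simp
next
  case (insert k I)
  show ?case
  proof (cases "\<forall>v\<in>W. (\<forall>i\<in>I. 0 \<le> \<phi> i v) \<longrightarrow> 0 \<le> \<psi> v")
    case True
    then obtain c where c: "\<forall>i\<in>I. 0 \<le> c i" "\<forall>v\<in>W. \<psi> v = (\<Sum>i\<in>I. c i * \<phi> i v)"
      using insert.IH[of \<phi> \<psi>] insert.prems by blast
    have "(\<Sum>i\<in>insert k I. (c(k := 0)) i * \<phi> i v) = (\<Sum>i\<in>I. c i * \<phi> i v)" for v
      using insert.hyps by (auto intro!: sum.cong)
    with c show ?thesis by (intro exI[of _ "c(k := 0)"]) auto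
  next
    case False
    then obtain u where u: "u \<in> W" "\<forall>i\<in>I. 0 \<le> \<phi> i u" "\<psi> u < 0" by force
    have ku: "\<phi> k u < 0" using insert.prems(3)[OF u(1)] u by force
    define \<kappa> where "\<kappa> = - 1 / \<phi> k u"
    have \<kappa>: "0 < \<kappa>" "\<kappa> * \<phi> k u = - 1" using ku by (auto simp: \<kappa>_def divide_simps)
    \<comment> \<open>Compose every functional with the projection of \<open>W\<close> along \<open>u\<close> onto the kernel of \<open>\<phi> k\<close>.\<close>
    define \<pi> where "\<pi> v = comb (\<kappa> * \<phi> k v) v u" for v
    have \<pi>W: "\<pi> v \<in> W" if "v \<in> W" for v using that u W by (simp add: \<pi>_def)
    have \<pi>\<phi>: "\<phi> i (\<pi> v) = \<phi> i v + \<kappa> * \<phi> k v * \<phi> i u" if "v \<in> W" "i \<in> insert k I" for v i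
      using that u insert.prems(1) by (simp add: \<pi>_def)
    have \<pi>\<psi>: "\<psi> (\<pi> v) = \<psi> v + \<kappa> * \<phi> k v * \<psi> u" if "v \<in> W" for v
      using that u insert.prems(2) by (simp add: \<pi>_def)
    have \<pi>k: "\<phi> k (\<pi> v) = 0" if "v \<in> W" for v
    proof -
      have "\<phi> k (\<pi> v) = \<phi> k v * (1 + \<kappa> * \<phi> k u)"
        using \<pi>\<phi>[OF that, of k] by (simp add: algebra_simps)
      then show ?thesis using \<kappa>(2) by simp
    qed
    have "\<exists>c. (\<forall>i\<in>I. 0 \<le> c i) \<and> (\<forall>v\<in>W. (\<psi> \<circ> \<pi>) v = (\<Sum>i\<in>I. c i * (\<phi> i \<circ> \<pi>) v))"
    proof (rule insert.IH)
      fix i s v w assume "i \<in> I" "v \<in> W" "w \<in> W"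
      then show "(\<phi> i \<circ> \<pi>) (comb s v w) = (\<phi> i \<circ> \<pi>) v + s * (\<phi> i \<circ> \<pi>) w"
        using W insert.prems(1) by (simp add: \<pi>\<phi> algebra_simps)
    next
      fix s v w assume "v \<in> W" "w \<in> W"
      then show "(\<psi> \<circ> \<pi>) (comb s v w) = (\<psi> \<circ> \<pi>) v + s * (\<psi> \<circ> \<pi>) w"
        using W insert.prems(1,2) by (simp add: \<pi>\<psi> algebra_simps)
    next
      fix v assume "v \<in> W" "\<forall>i\<in>I. 0 \<le> (\<phi> i \<circ> \<pi>) v"
      \<comment> \<open>\<open>\<pi> v\<close> meets constraint \<open>k\<close> with equality, so
        it satisfies all constraints of the original system.\<close>
      then show "0 \<le> (\<psi> \<circ> \<pi>) v"
        using insert.prems(3)[OF \<pi>W] \<pi>k by auto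
    qed
    then obtain c where c: "\<forall>i\<in>I. 0 \<le> c i" "\<And>v. v \<in> W \<Longrightarrow> \<psi> (\<pi> v) = (\<Sum>i\<in>I. c i * \<phi> i (\<pi> v))"
      by auto
    \<comment> \<open>The coefficient of \<open>\<phi> k\<close> found by expanding
      \<open>\<pi>\<close>. It is nonnegative because \<open>u\<close> satisfies the constraints in
      \<open>I\<close> but has \<open>\<psi> u < 0\<close>.\<close>
    define d where "d = \<kappa> * ((\<Sum>i\<in>I. c i * \<phi> i u) - \<psi> u)"
    have "0 \<le> (\<Sum>i\<in>I. c i * \<phi> i u)" using c(1) u(2) by (auto intro!: sum_nonneg)
    then have "0 \<le> d" using u(3) \<kappa>(1) by (simp add: d_def)
    moreover have "\<psi> v = (\<Sum>i\<in>insert k I. (c(k := d)) i * \<phi> i v)" if "v \<in> W" for v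
    proof -
      have "\<psi> v = (\<Sum>i\<in>I. c i * (\<phi> i v + \<kappa> * \<phi> k v * \<phi> i u)) - \<kappa> * \<phi> k v * \<psi> u"
        using c(2)[OF that] \<pi>\<psi>[OF that] \<pi>\<phi>[OF that] by simp
      also have "\<dots> = (\<Sum>i\<in>I. c i * \<phi> i v) + d * \<phi> k v"
        by (simp add: d_def algebra_simps sum.distrib sum_distrib_left)
      also have "\<dots> = (\<Sum>i\<in>insert k I. (c(k := d)) i * \<phi> i v)"
        using insert.hyps by (auto intro!: sum.cong simp: algebra_simps)
      finally show ?thesis .
    qed
    ultimately show ?thesis using c(1) by (intro exI[of _ "c(k := d)"]) auto
  qed
qed

subsection \<open>Extended formulations of CLIQUE\<close>

lemma frob_sum: "frob n w (\<lambda>ij. \<Sum>p\<in>S. c p * h p ij) = (\<Sum>p\<in>S. c p * frob n w (h p))"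
proof -
  have "frob n w (\<lambda>ij. \<Sum>p\<in>S. c p * h p ij) = (\<Sum>i<n. \<Sum>p\<in>S. \<Sum>j<n. c p * (w (i, j) * h p (i, j)))"
    unfolding frob_def sum_distrib_left
    by (intro sum.cong refl, subst sum.swap) (simp add: mult.left_commute)
  then show ?thesis
    by (subst (asm) sum.swap) (simp add: frob_def sum_distrib_left)
qed

lemma frob_commute: "frob n w x = frob n x w"
  by (simp add: frob_def mult.commute)

lemma frob_sum_left: "frob n (\<lambda>ij. \<Sum>p\<in>S. c p * h p ij) x = (\<Sum>p\<in>S. c p * frob n (h p) x)"
  using frob_sum[of n x c h S] by (simp only: frob_commute)

lemma frob_add_scaled: "frob n w (\<lambda>ij. x ij + s * y ij) = frob n w x + s * frob n w y"
  by (simp add: frob_def algebra_simps sum.distrib sum_distrib_left)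

lemma frob_scaled: "frob n w (\<lambda>ij. s * y ij) = s * frob n w y"
  by (simp add: frob_def algebra_simps sum_distrib_left)

section \<open>Vertices of the polytope and edgeless objectives\<close>

definition clique_point :: "nat set \<Rightarrow> nat \<times> nat \<Rightarrow> real" where
  "clique_point b = (\<lambda>(i, j). of_bool (i \<in> b) * of_bool (j \<in> b))"

lemma clique_points_eq: "clique_points n = clique_point ` Pow {..<n}"
proof (intro equalityI subsetI)
  fix p assume "p \<in> clique_points n"
  then obtain b where b: "p = (\<lambda>(i, j). b i * b j)" "\<And>i. i < n \<Longrightarrow> b i = 0 \<or> b i = 1" "\<And>i. i \<ge> n \<Longrightarrow> b i = 0"
    unfolding clique_points_def by auto
  have "b i = of_bool (i \<in> {i. i < n \<and> b i = 1})" for i :: nat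
    using b(2,3)[of i] by (cases "i < n") auto
  then have "p = clique_point {i. i < n \<and> b i = 1}"
    unfolding b(1) clique_point_def by metis
  then show "p \<in> clique_point ` Pow {..<n}" by auto
next
  fix p assume "p \<in> clique_point ` Pow {..<n}"
  then obtain b where b: "b \<subseteq> {..<n}" "p = clique_point b" by auto
  then have "\<forall>i\<ge>n. (of_bool (i \<in> b) :: real) = 0" by auto
  then show "p \<in> clique_points n"
    unfolding clique_points_def b(2) clique_point_def
    by (intro CollectI exI[of _ "\<lambda>i. of_bool (i \<in> b)"]) auto
qed

lemma clique_point_in_polytope: "b \<subseteq> {..<n} \<Longrightarrow> clique_point b \<in> clique_polytope n"
  unfolding clique_polytope_def clique_points_eq
  by (intro CollectI exI[of _ "{clique_point b}"] exI[of _ "\<lambda>_. 1"]) auto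

lemma frob_polytope_le:
  assumes x: "x \<in> clique_polytope n"
    and B: "\<And>b. b \<subseteq> {..<n} \<Longrightarrow> frob n w (clique_point b) \<le> B"
  shows "frob n w x \<le> B"
proof -
  obtain S c where S: "S \<subseteq> clique_points n" "\<And>p. p \<in> S \<Longrightarrow> 0 \<le> c p" "(\<Sum>p\<in>S. c p) = 1"
    and x: "x = (\<lambda>ij. \<Sum>p\<in>S. c p * p ij)"
    using x unfolding clique_polytope_def by auto
  have "frob n w x = (\<Sum>p\<in>S. c p * frob n w p)"
    unfolding x by (rule frob_sum)
  also have "\<dots> \<le> (\<Sum>p\<in>S. c p * B)"
    using S(1,2) B by (intro sum_mono mult_left_mono) (auto simp: clique_points_eq)
  also have "\<dots> = B" using S(3) by (simp add: sum_distrib_right[symmetric])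
  finally show ?thesis .
qed

text \<open>A linear functional on the hull of finitely many points is maximal at one of them. This
  is what makes the real supremum in \<open>Pmax\<close> meaningful.\<close>

lemma Pmax_attained:
  obtains b where "b \<subseteq> {..<n}" "Pmax n w = frob n w (clique_point b)"
    "\<And>x. x \<in> clique_polytope n \<Longrightarrow> frob n w x \<le> Pmax n w"
proof -
  define B where "B = Max ((\<lambda>b. frob n w (clique_point b)) ` Pow {..<n})"
  have le: "frob n w (clique_point b) \<le> B" if "b \<subseteq> {..<n}" for b
    unfolding B_def using that by (intro Max_ge) auto
  have "B \<in> (\<lambda>b. frob n w (clique_point b)) ` Pow {..<n}"
    unfolding B_def by (intro Max_in) auto
  then obtain b where b: "b \<subseteq> {..<n}" "B = frob n w (clique_point b)" by auto
  have le': "frob n w x \<le> B" if "x \<in> clique_polytope n" for x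
    using frob_polytope_le[OF that le] .
  have "Pmax n w = B"
    unfolding Pmax_def
    using le' b(2) clique_point_in_polytope[OF b(1)] by (intro cSup_eq_maximum) auto
  with b le' show ?thesis by (intro that[of b]) auto
qed

lemma frob_clique_point_le_Pmax:
  assumes "b \<subseteq> {..<n}"
  shows "frob n w (clique_point b) \<le> Pmax n w"
  using Pmax_attained[of n w] clique_point_in_polytope[OF assms] by metis

lemma sum_of_bool_mem:
  fixes c :: "nat set"
  assumes "c \<subseteq> {..<n}"
  shows "(\<Sum>i<n. of_bool (i \<in> c) :: real) = real (card c)"
proof -
  have "{..<n} \<inter> {i. i \<in> c} = c" using assms by auto
  then show ?thesis by (subst sum_of_bool_eq) simp_all
qed

text \<open>With \<open>k = card (a \<inter> b)\<close> there are \<open>k\<close> diagonal ones and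
  \<open>k * (k - 1)\<close> off-diagonal entries -1. The value is \<open>1 - (1 - k)^2\<close>,
  which is 0 on disjoint pairs and 1 on pairs meeting once.\<close>

lemma frob_edgeless:
  assumes "b \<subseteq> {..<n}"
  shows "frob n (wG n a (\<lambda>_ _. False)) (clique_point b)
    = 2 * real (card (a \<inter> b)) - (real (card (a \<inter> b)))\<^sup>2"
proof -
  let ?c = "a \<inter> b"
  have c: "?c \<subseteq> {..<n}" using assms by auto
  \<comment> \<open>Writing the diagonal weight 1 as 2 - 1 leaves a rank-one matrix to
    subtract.\<close>
  have "frob n (wG n a (\<lambda>_ _. False)) (clique_point b)
    = (\<Sum>i<n. \<Sum>j<n. (if j = i then 2 * of_bool (i \<in> ?c) else 0) - of_bool (i \<in> ?c) * of_bool (j \<in> ?c))"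
    unfolding frob_def by (intro sum.cong refl) (auto simp: wG_def clique_point_def)
  also have "\<dots> = (\<Sum>i<n. 2 * of_bool (i \<in> ?c) - of_bool (i \<in> ?c) * (\<Sum>j<n. of_bool (j \<in> ?c)))"
    unfolding sum_subtractf sum_distrib_left by simp
  also have "\<dots> = 2 * real (card ?c) - real (card ?c) * real (card ?c)"
    by (simp only: sum_subtractf sum_distrib_left[symmetric] sum_distrib_right[symmetric] sum_of_bool_mem[OF c])
  finally show ?thesis by (simp add: power2_eq_square)
qed

section \<open>Linear programming duality for extended formulations\<close>

text \<open>Farkas' lemma on the homogenized system: the slack of a valid inequality is a
  nonnegative combination of the \<open>y l\<close> and a constant. The multipliers depend on the
  inequality alone, which the factorization requires.\<close>

lemma ef_proj_valid_ineq:
  assumes ne: "ef_proj n m r E F g \<noteq> {}"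
    and valid: "\<And>x. x \<in> ef_proj n m r E F g \<Longrightarrow> frob n w x \<le> \<beta>"
  shows "\<exists>T. (\<forall>l. 0 \<le> T l) \<and>
    (\<forall>x y. (\<forall>k<m. frob n (E k) x + (\<Sum>l<r. F k l * y l) = g k) \<longrightarrow>
       \<beta> - frob n w x = (\<Sum>l<r. T l * y l) + T r)"
proof -
  \<comment> \<open>\<open>\<tau>\<close> scales the right-hand side, which makes the solution set
    linear. As the functional with index \<open>r\<close> it later supplies the constant
    \<open>T r\<close>.\<close>
  define W where "W = {(x, y, \<tau>). \<forall>k<m. frob n (E k) x + (\<Sum>l<r. F k l * y l) = \<tau> * g k}"
  define comb :: "real \<Rightarrow> (nat \<times> nat \<Rightarrow> real) \<times> (nat \<Rightarrow> real) \<times> real \<Rightarrow> _ \<Rightarrow> _" where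
    "comb s = (\<lambda>(x, y, \<tau>) (x', y', \<tau>'). (\<lambda>ij. x ij + s * x' ij, \<lambda>l. y l + s * y' l, \<tau> + s * \<tau>'))" for s
  define \<phi> :: "nat \<Rightarrow> (nat \<times> nat \<Rightarrow> real) \<times> (nat \<Rightarrow> real) \<times> real \<Rightarrow> real" where
    "\<phi> l = (\<lambda>(x, y, \<tau>). if l < r then y l else \<tau>)" for l
  define \<psi> :: "(nat \<times> nat \<Rightarrow> real) \<times> (nat \<Rightarrow> real) \<times> real \<Rightarrow> real" where
    "\<psi> = (\<lambda>(x, y, \<tau>). \<beta> * \<tau> - frob n w x)"
  have sum_comb: "(\<Sum>l<r. F k l * (y l + s * y' l)) = (\<Sum>l<r. F k l * y l) + s * (\<Sum>l<r. F k l * y' l)"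
    for k s y y' by (simp add: distrib_left mult.left_commute sum.distrib sum_distrib_left)
  obtain x0 y0 where x0: "\<And>l. l < r \<Longrightarrow> 0 \<le> y0 l"
    "\<And>k. k < m \<Longrightarrow> frob n (E k) x0 + (\<Sum>l<r. F k l * y0 l) = g k"
    using ne unfolding ef_proj_def by auto
  have "\<exists>c. (\<forall>i\<in>{..<Suc r}. 0 \<le> c i) \<and> (\<forall>v\<in>W. \<psi> v = (\<Sum>i\<in>{..<Suc r}. c i * \<phi> i v))"
  proof (rule farkas[of _ _ comb])
    fix s u v assume uv: "u \<in> W" "v \<in> W"
    obtain x y \<tau> x' y' \<tau>' where u_eq: "u = (x, y, \<tau>)" and v_eq: "v = (x', y', \<tau>')"
      by (cases u, cases v)
    have "frob n (E k) (\<lambda>ij. x ij + s * x' ij) + (\<Sum>l<r. F k l * (y l + s * y' l)) = (\<tau> + s * \<tau>') * g k"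
      if "k < m" for k
    proof -
      have "frob n (E k) x + (\<Sum>l<r. F k l * y l) = \<tau> * g k"
        "frob n (E k) x' + (\<Sum>l<r. F k l * y' l) = \<tau>' * g k"
        using uv that by (auto simp: W_def u_eq v_eq)
      moreover have "(a + s * a') + (b + s * b') = (a + b) + s * (a' + b')" for a a' b b'
        by (simp add: algebra_simps)
      ultimately show ?thesis
        unfolding frob_add_scaled sum_comb by (simp only:) (simp add: algebra_simps)
    qed
    then show "comb s u v \<in> W"
      by (simp add: W_def comb_def u_eq v_eq)
  next
    fix i s u v assume "u \<in> W" "v \<in> W"
    show "\<phi> i (comb s u v) = \<phi> i u + s * \<phi> i v"
      by (auto simp: \<phi>_def comb_def split: prod.splits)
  next
    fix s u v assume "u \<in> W" "v \<in> W"
    show "\<psi> (comb s u v) = \<psi> u + s * \<psi> v"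
      by (auto simp: \<psi>_def comb_def frob_add_scaled algebra_simps split: prod.splits)
  next
    fix v assume v: "v \<in> W" "\<forall>i\<in>{..<Suc r}. 0 \<le> \<phi> i v"
    obtain x y \<tau> where v_eq: "v = (x, y, \<tau>)" by (cases v)
    have y: "0 \<le> y l" if "l < r" for l using bspec[OF v(2), of l] that by (simp add: v_eq \<phi>_def)
    have \<tau>: "0 \<le> \<tau>" using bspec[OF v(2), of r] by (simp add: v_eq \<phi>_def)
    have eq: "frob n (E k) x + (\<Sum>l<r. F k l * y l) = \<tau> * g k" if "k < m" for k
      using v(1) that by (simp add: v_eq W_def)
    \<comment> \<open>\<open>(x0 + t x) / (1 + t \<tau>)\<close> is feasible for all \<open>t \<ge> 0\<close>; let \<open>t\<close> tend to infinity.\<close>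
    have ray: "frob n w x0 - \<beta> \<le> t * \<psi> v" if t: "0 \<le> t" for t
    proof -
      define q where "q = 1 + t * \<tau>"
      have q: "0 < q" using t \<tau> by (simp add: q_def add_pos_nonneg)
      have "(\<lambda>ij. (1 / q) * (x0 ij + t * x ij)) \<in> ef_proj n m r E F g"
        unfolding ef_proj_def
      proof (intro CollectI exI[of _ "\<lambda>l. (1 / q) * (y0 l + t * y l)"] conjI allI impI)
        show "0 \<le> 1 / q * (y0 l + t * y l)" if "l < r" for l
          using x0(1)[OF that] y[OF that] t q by simp
      next
        fix k assume k: "k < m"
        have "(\<Sum>l<r. F k l * (1 / q * (y0 l + t * y l))) = 1 / q * (\<Sum>l<r. F k l * (y0 l + t * y l))"
          by (simp add: sum_distrib_left mult.left_commute sum_divide_distrib)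
        then have "frob n (E k) (\<lambda>ij. 1 / q * (x0 ij + t * x ij)) + (\<Sum>l<r. F k l * (1 / q * (y0 l + t * y l)))
          = 1 / q * (frob n (E k) x0 + (\<Sum>l<r. F k l * y0 l) + t * (frob n (E k) x + (\<Sum>l<r. F k l * y l)))"
          by (simp only: frob_scaled frob_add_scaled sum_comb) (simp add: algebra_simps add_divide_distrib)
        also have "\<dots> = 1 / q * (q * g k)"
          unfolding x0(2)[OF k] eq[OF k] by (simp add: q_def algebra_simps)
        finally show "frob n (E k) (\<lambda>ij. 1 / q * (x0 ij + t * x ij)) + (\<Sum>l<r. F k l * (1 / q * (y0 l + t * y l))) = g k"
          using q by simp
      qed
      from valid[OF this] have "frob n w x0 + t * frob n w x \<le> \<beta> * q"
        using q by (simp only: frob_scaled frob_add_scaled) (simp add: pos_divide_le_eq)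
      then show ?thesis by (simp add: \<psi>_def v_eq q_def algebra_simps)
    qed
    show "0 \<le> \<psi> v"
    proof (rule ccontr)
      assume "\<not> 0 \<le> \<psi> v"
      then have neg: "\<psi> v < 0" by simp
      have "frob n w x0 \<le> \<beta>" using ray[of 0] by simp
      \<comment> \<open>At this \<open>t\<close> the bound \<open>t * \<psi> v\<close> equals
        \<open>frob n w x0 - \<beta> - 1\<close>, a contradiction.\<close>
      then have "frob n w x0 - \<beta> \<le> (\<beta> - frob n w x0 + 1) / (- \<psi> v) * \<psi> v"
        using neg by (intro ray divide_nonneg_pos) auto
      then show False using neg by simp
    qed
  qed simp
  then obtain c where c: "\<And>i. i < Suc r \<Longrightarrow> 0 \<le> c i"
    "\<And>v. v \<in> W \<Longrightarrow> \<psi> v = (\<Sum>i<Suc r. c i * \<phi> i v)" by auto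
  show ?thesis
  proof (intro exI[of _ "\<lambda>l. if l < Suc r then c l else 0"] conjI allI impI)
    fix x y assume "\<forall>k<m. frob n (E k) x + (\<Sum>l<r. F k l * y l) = g k"
    then have "(x, y, 1) \<in> W" by (simp add: W_def)
    from c(2)[OF this] show "\<beta> - frob n w x = (\<Sum>l<r. (if l < Suc r then c l else 0) * y l)
        + (if r < Suc r then c r else 0)"
      by (simp add: \<psi>_def \<phi>_def)
  qed (simp add: c(1))
qed

text \<open>Projections of polyhedra are closed and convex, so no functional separates such a
  \<open>p\<close> from the projection. Concretely, multipliers \<open>z\<close> of the equations
  with nonnegative coefficients on \<open>y\<close> yield a valid inequality, which passes to
  \<open>p\<close>; Farkas' lemma over all \<open>z\<close> then returns a lift of
  \<open>p\<close>.\<close>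

lemma frob_le_SUP_imp_ef_proj:
  assumes sup: "\<And>w. ereal (frob n w p) \<le> (SUP x\<in>ef_proj n m r E F g. ereal (frob n w x))"
  shows "p \<in> ef_proj n m r E F g"
proof -
  define \<phi> where "\<phi> l z = (\<Sum>k<m. z k * F k l)" for l and z :: "nat \<Rightarrow> real"
  define \<psi> where "\<psi> z = (\<Sum>k<m. z k * (g k - frob n (E k) p))" for z :: "nat \<Rightarrow> real"
  have "\<exists>c. (\<forall>l\<in>{..<r}. 0 \<le> c l) \<and> (\<forall>z\<in>UNIV. \<psi> z = (\<Sum>l\<in>{..<r}. c l * \<phi> l z))"
  proof (rule farkas[where comb = "\<lambda>s u v k. u k + s * v k"])
    fix z assume z: "\<forall>l\<in>{..<r}. 0 \<le> \<phi> l z"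
    define w where "w = (\<lambda>ij. \<Sum>k<m. z k * E k ij)"
    have "(SUP x\<in>ef_proj n m r E F g. ereal (frob n w x)) \<le> ereal (\<Sum>k<m. z k * g k)"
    proof (rule SUP_least)
      fix x assume "x \<in> ef_proj n m r E F g"
      then obtain y where y: "\<And>l. l < r \<Longrightarrow> 0 \<le> y l"
        "\<And>k. k < m \<Longrightarrow> frob n (E k) x + (\<Sum>l<r. F k l * y l) = g k"
        unfolding ef_proj_def by auto
      have "0 \<le> (\<Sum>l<r. \<phi> l z * y l)"
        using z y(1) by (intro sum_nonneg) auto
      also have "\<dots> = (\<Sum>k<m. z k * (\<Sum>l<r. F k l * y l))"
        unfolding \<phi>_def sum_distrib_right sum_distrib_left by (subst sum.swap) (simp add: mult.assoc)
      finally have "(\<Sum>k<m. z k * frob n (E k) x) \<le> (\<Sum>k<m. z k * (frob n (E k) x + (\<Sum>l<r. F k l * y l)))"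
        by (simp add: distrib_left sum.distrib)
      also have "\<dots> = (\<Sum>k<m. z k * g k)" using y(2) by simp
      finally show "ereal (frob n w x) \<le> ereal (\<Sum>k<m. z k * g k)"
        by (simp add: w_def frob_sum_left)
    qed
    with sup[of w] have "ereal (frob n w p) \<le> ereal (\<Sum>k<m. z k * g k)" by (rule order_trans)
    then show "0 \<le> \<psi> z"
      by (simp add: \<psi>_def w_def frob_sum_left right_diff_distrib sum_subtractf)
  qed (auto simp: \<phi>_def \<psi>_def algebra_simps sum.distrib sum_distrib_left sum_subtractf)
  then obtain c where c: "\<And>l. l < r \<Longrightarrow> 0 \<le> c l" "\<And>z. \<psi> z = (\<Sum>l<r. c l * \<phi> l z)" by auto
  have "frob n (E k) p + (\<Sum>l<r. F k l * c l) = g k" if k: "k < m" for k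
  proof -
    have pick: "(\<Sum>k'<m. (if k' = k then 1 else 0) * h k') = h k" for h :: "nat \<Rightarrow> real"
      using k by (simp add: if_distrib[of "\<lambda>t. t * _"] cong: if_cong)
    \<comment> \<open>Unit vectors as multipliers recover the equations one at a time.\<close>
    show ?thesis
      using c(2)[of "\<lambda>k'. if k' = k then 1 else 0"] by (simp only: \<psi>_def \<phi>_def pick) (simp add: mult.commute)
  qed
  with c(1) show ?thesis unfolding ef_proj_def by auto
qed

section \<open>From an extended formulation to a size bound\<close>

text \<open>Yannakakis' argument: the slack of vertex \<open>b\<close> in the inequality of the
  edgeless graph on \<open>a\<close> pairs multipliers depending on \<open>a\<close> with a lift
  depending on \<open>b\<close>. Index \<open>r\<close> carries the constant term, with lift
  coordinate 1, so the rank is at most \<open>r + 1\<close>.\<close>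

lemma approx_EF_factorization:
  assumes EF: "approx_EF n \<rho> m r E F g" and \<rho>: "0 \<le> \<rho>"
  shows "\<exists>T y. (\<forall>a\<subseteq>{..<n}. \<forall>l. 0 \<le> T a l) \<and> (\<forall>b\<subseteq>{..<n}. \<forall>l<Suc r. 0 \<le> y b l) \<and>
    (\<forall>a\<subseteq>{..<n}. \<forall>b\<subseteq>{..<n}. (\<Sum>l<Suc r. T a l * y b l)
      = \<rho> - (2 * real (card (a \<inter> b)) - (real (card (a \<inter> b)))\<^sup>2))"
proof -
  let ?K = "ef_proj n m r E F g"
  have sup: "ereal (Pmax n w) \<le> (SUP x\<in>?K. ereal (frob n w x))" for w
    using EF by (simp add: approx_EF_def)
  have cp: "clique_point b \<in> ?K" if "b \<subseteq> {..<n}" for b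
  proof (rule frob_le_SUP_imp_ef_proj)
    show "ereal (frob n w (clique_point b)) \<le> (SUP x\<in>?K. ereal (frob n w x))" for w
      using frob_clique_point_le_Pmax[OF that, of w] by (intro order_trans[OF _ sup]) simp
  qed
  have "\<forall>a\<in>Pow {..<n}. \<exists>T. (\<forall>l. 0 \<le> T l) \<and> (\<forall>x y. (\<forall>k<m. frob n (E k) x + (\<Sum>l<r. F k l * y l) = g k) \<longrightarrow>
      \<rho> - frob n (wG n a (\<lambda>_ _. False)) x = (\<Sum>l<r. T l * y l) + T r)"
  proof
    fix a assume "a \<in> Pow {..<n}"
    let ?w = "wG n a (\<lambda>_ _. False)"
    \<comment> \<open>An edgeless graph has clique number at most 1, hence \<open>\<rho>\<close>
      itself is a valid right-hand side.\<close>
    have "Pmax n ?w \<le> 1"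
    proof (rule Pmax_attained[of n ?w])
      fix b assume b: "b \<subseteq> {..<n}" "Pmax n ?w = frob n ?w (clique_point b)"
      have "2 * k - k\<^sup>2 \<le> 1" for k :: real
        using zero_le_power2[of "k - 1"] by (simp add: power2_diff)
      then show ?thesis unfolding b(2) frob_edgeless[OF b(1)] .
    qed
    then have "\<rho> * Pmax n ?w \<le> \<rho>" using \<rho> by (simp add: mult_left_le)
    moreover have "is_graph n a (\<lambda>_ _. False)" using \<open>a \<in> Pow {..<n}\<close> by (simp add: is_graph_def)
    then have "(SUP x\<in>?K. ereal (frob n ?w x)) \<le> ereal (\<rho> * Pmax n ?w)"
      using EF unfolding approx_EF_def by blast
    ultimately have "(SUP x\<in>?K. ereal (frob n ?w x)) \<le> ereal \<rho>"
      by (meson ereal_less_eq(3) order_trans)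
    then have valid: "frob n ?w x \<le> \<rho>" if "x \<in> ?K" for x
      using that by (simp add: SUP_le_iff)
    have "?K \<noteq> {}" using cp[of "{}"] by auto
    from ef_proj_valid_ineq[OF this valid] show "\<exists>T. (\<forall>l. 0 \<le> T l) \<and>
      (\<forall>x y. (\<forall>k<m. frob n (E k) x + (\<Sum>l<r. F k l * y l) = g k) \<longrightarrow>
        \<rho> - frob n ?w x = (\<Sum>l<r. T l * y l) + T r)" .
  qed
  from bchoice[OF this] obtain T where T: "\<forall>a\<in>Pow {..<n}. (\<forall>l. 0 \<le> T a l) \<and>
      (\<forall>x y. (\<forall>k<m. frob n (E k) x + (\<Sum>l<r. F k l * y l) = g k) \<longrightarrow>
        \<rho> - frob n (wG n a (\<lambda>_ _. False)) x = (\<Sum>l<r. T a l * y l) + T a r)" ..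
  have "\<forall>b\<in>Pow {..<n}. \<exists>y. (\<forall>l<r. 0 \<le> y l) \<and>
      (\<forall>k<m. frob n (E k) (clique_point b) + (\<Sum>l<r. F k l * y l) = g k)"
    using cp unfolding ef_proj_def by auto
  from bchoice[OF this] obtain y where y: "\<forall>b\<in>Pow {..<n}. (\<forall>l<r. 0 \<le> y b l) \<and>
      (\<forall>k<m. frob n (E k) (clique_point b) + (\<Sum>l<r. F k l * y b l) = g k)" ..
  have "(\<Sum>l<Suc r. T a l * (if l < r then y b l else 1))
      = \<rho> - (2 * real (card (a \<inter> b)) - (real (card (a \<inter> b)))\<^sup>2)"
    if ab: "a \<subseteq> {..<n}" "b \<subseteq> {..<n}" for a b
  proof -
    have "\<forall>k<m. frob n (E k) (clique_point b) + (\<Sum>l<r. F k l * y b l) = g k"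
      using bspec[OF y PowI[OF ab(2)]] by (rule conjunct2)
    then have "\<rho> - frob n (wG n a (\<lambda>_ _. False)) (clique_point b) = (\<Sum>l<r. T a l * y b l) + T a r"
      using bspec[OF T PowI[OF ab(1)], THEN conjunct2, rule_format, of "clique_point b" "y b"] by simp
    then show ?thesis unfolding frob_edgeless[OF ab(2)] by simp
  qed
  with T y show ?thesis
    by (intro exI[of _ T] exI[of _ "\<lambda>b l. if l < r then y b l else 1"]) simp
qed

lemma approx_EF_size_lower_bound:
  assumes EF: "approx_EF n \<rho> m r E F g" and \<rho>: "1 \<le> \<rho>" "\<rho> \<le> real n" and n: "0 < n"
  shows "exp (real n / (1024 * \<rho>\<^sup>2)) \<le> 1024 * (real n)\<^sup>2 * (real r + 1)"
proof -
  obtain T y where T: "\<forall>a\<subseteq>{..<n}. \<forall>l. 0 \<le> T a l" and y: "\<forall>b\<subseteq>{..<n}. \<forall>l<Suc r. 0 \<le> y b l"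
    and eq: "\<forall>a\<subseteq>{..<n}. \<forall>b\<subseteq>{..<n}. (\<Sum>l<Suc r. T a l * y b l)
      = \<rho> - (2 * real (card (a \<inter> b)) - (real (card (a \<inter> b)))\<^sup>2)"
    using approx_EF_factorization[OF EF order_trans[OF zero_le_one \<rho>(1)]] by (elim exE conjE) (rule that)
  have n2: "real n \<le> (real n)\<^sup>2" using n by (simp add: power2_eq_square)
  \<comment> \<open>The entries are at most \<open>\<rho> + n^2\<close>, and
    \<open>\<rho> \<le> n \<le> n^2\<close> gives the bound \<open>2 * n^2\<close> in the role of
    \<open>L\<close>.\<close>
  have "real (card {..<n}) * exp (card {..<n} / (1024 * \<rho>\<^sup>2)) \<le> 512 * \<rho> * (2 * (real n)\<^sup>2) * card {..<Suc r}"
  proof (rule shifted_disjointness_rank[where u = "\<lambda>l a. T a l" and v = "\<lambda>l b. y b l"])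
    fix a b assume ab: "a \<subseteq> {..<n}" "b \<subseteq> {..<n}"
    have "card (a \<inter> b) \<le> card {..<n}" using ab by (intro card_mono) auto
    then have "(real (card (a \<inter> b)))\<^sup>2 \<le> (real n)\<^sup>2" by (intro power_mono) auto
    then show "(\<Sum>l<Suc r. T a l * y b l) \<le> 2 * (real n)\<^sup>2"
      using \<rho>(2) n2 eq[rule_format, OF ab] by linarith
  qed (use n lessThan_empty_iff[of n] \<rho> T y eq in \<open>auto simp del: sum.lessThan_Suc\<close>)
  then have "real n * exp (real n / (1024 * \<rho>\<^sup>2)) \<le> \<rho> * (1024 * (real n)\<^sup>2 * (real r + 1))"
    by (simp add: algebra_simps)
  also have "\<dots> \<le> real n * (1024 * (real n)\<^sup>2 * (real r + 1))"
    using \<rho>(2) by (intro mult_right_mono) auto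
  finally show ?thesis using n by (simp add: mult_le_cancel_left_pos)
qed

section \<open>The box relaxation\<close>

text \<open>On the box [0, 1]^(n x n) only the diagonal contributes positively to an admissible
  objective, so its value is at most \<open>n\<close>, while a nonempty graph has a clique of size
  1. Index \<open>k\<close> encodes the entry \<open>i * n + j = k div 2\<close>; even
  \<open>k\<close> encodes \<open>x = y\<close>, odd \<open>k\<close> encodes
  \<open>x + y = 1\<close>.\<close>

lemma box_approx_EF:
  assumes n: "0 < n"
  shows "\<exists>m E F g. approx_EF n (real n) m (2 * (n * n)) E F g"
proof -
  define p where "p k = ((k div 2) div n, (k div 2) mod n)" for k
  define E :: "nat \<Rightarrow> nat \<times> nat \<Rightarrow> real" where "E k ij = of_bool (ij = p k)" for k ij
  define F :: "nat \<Rightarrow> nat \<Rightarrow> real" where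
    "F k l = (if l = k then (if even k then -1 else 1) else 0)" for k l
  define g :: "nat \<Rightarrow> real" where "g k = of_bool (odd k)" for k
  let ?r = "2 * (n * n)"
  let ?K = "ef_proj n ?r ?r E F g"
  have frobE: "frob n (E k) x = x (p k)" if "k < ?r" for k x
  proof -
    obtain a b where ab: "p k = (a, b)" by force
    have k: "a < n" "b < n"
      using ab that n by (auto simp: p_def intro!: less_mult_imp_div_less)
    have "frob n (E k) x = (\<Sum>i<n. \<Sum>j<n. if j = b then (if i = a then x (i, j) else 0) else 0)"
      unfolding frob_def by (intro sum.cong refl) (auto simp: E_def ab)
    also have "\<dots> = x (p k)" using k by (simp add: ab)
    finally show ?thesis .
  qed
  have sumF: "(\<Sum>l<?r. F k l * y l) = (if even k then - y k else y k)" if "k < ?r" for k and y :: "nat \<Rightarrow> real"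
  proof -
    have "(\<Sum>l<?r. F k l * y l) = (\<Sum>l<?r. if l = k then (if even k then - y k else y k) else 0)"
      by (intro sum.cong) (auto simp: F_def)
    then show ?thesis using that by simp
  qed
  have K: "clique_point b \<in> ?K" for b
    unfolding ef_proj_def
  proof (intro CollectI exI[of _ "\<lambda>l. if even l then clique_point b (p l) else 1 - clique_point b (p l)"]
      conjI allI impI)
    show "0 \<le> (if even l then clique_point b (p l) else 1 - clique_point b (p l))" for l
      by (simp add: clique_point_def split: prod.splits)
  qed (simp add: frobE sumF g_def)
  have box: "0 \<le> x (i, j) \<and> x (i, j) \<le> 1" if "x \<in> ?K" "i < n" "j < n" for x i j
  proof -
    obtain y where y: "\<And>l. l < ?r \<Longrightarrow> 0 \<le> y l"
      "\<And>k. k < ?r \<Longrightarrow> frob n (E k) x + (\<Sum>l<?r. F k l * y l) = g k"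
      using \<open>x \<in> ?K\<close> unfolding ef_proj_def by auto
    let ?k = "2 * (i * n + j)"
    have "i * n + j < Suc i * n" using that by simp
    also have "\<dots> \<le> n * n" using that by (intro mult_le_mono) auto
    finally have k: "?k < ?r" "Suc ?k < ?r" by auto
    have pk: "p ?k = (i, j)" "p (Suc ?k) = (i, j)" using that by (auto simp: p_def)
    have "x (i, j) - y ?k = 0" "x (i, j) + y (Suc ?k) = 1"
      using y(2)[OF k(1)] y(2)[OF k(2)] unfolding frobE[OF k(1)] frobE[OF k(2)] sumF[OF k(1)] sumF[OF k(2)] pk
      by (simp_all add: g_def)
    then show ?thesis using y(1)[OF k(1)] y(1)[OF k(2)] by simp
  qed
  have "approx_EF n (real n) ?r ?r E F g"
    unfolding approx_EF_def
  proof (intro conjI allI impI)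
    fix w
    show "ereal (Pmax n w) \<le> (SUP x\<in>?K. ereal (frob n w x))"
    proof (rule Pmax_attained[of n w])
      fix b assume "Pmax n w = frob n w (clique_point b)"
      then show ?thesis using K by (auto intro!: SUP_upper)
    qed
  next
    fix V Ed assume G: "is_graph n V Ed"
    \<comment> \<open>The graph without vertices has the zero objective, so the bound 1 is claimed
      only for nonempty \<open>V\<close>.\<close>
    have "(of_bool (V \<noteq> {}) :: real) \<le> Pmax n (wG n V Ed)"
    proof (cases "V = {}")
      case True
      have "frob n (wG n V Ed) (clique_point {}) = 0" by (simp add: frob_def clique_point_def)
      then show ?thesis using True frob_clique_point_le_Pmax[of "{}" n "wG n V Ed"] by simp
    next
      case False
      then obtain v where v: "v \<in> V" "v < n" using G by (auto simp: is_graph_def)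
      have "frob n (wG n V Ed) (clique_point {v}) = (\<Sum>i<n. \<Sum>j<n. if j = v then (if i = v then 1 else 0) else 0)"
        unfolding frob_def by (intro sum.cong refl) (auto simp: clique_point_def wG_def v)
      also have "\<dots> = 1" using v by simp
      finally show ?thesis using False v frob_clique_point_le_Pmax[of "{v}" n "wG n V Ed"] by simp
    qed
    then have P: "real n * of_bool (V \<noteq> {}) \<le> real n * Pmax n (wG n V Ed)"
      by (intro mult_left_mono) auto
    show "(SUP x\<in>?K. ereal (frob n (wG n V Ed) x)) \<le> ereal (real n * Pmax n (wG n V Ed))"
    proof (rule SUP_least)
      fix x assume x: "x \<in> ?K"
      have "frob n (wG n V Ed) x \<le> (\<Sum>i<n. \<Sum>j<n. if j = i then of_bool (V \<noteq> {}) else 0)"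
        unfolding frob_def
      proof (intro sum_mono)
        fix i j assume "i \<in> {..<n}" "j \<in> {..<n}"
        then have "0 \<le> x (i, j)" "x (i, j) \<le> 1" using box[OF x] by auto
        then show "wG n V Ed (i, j) * x (i, j) \<le> (if j = i then of_bool (V \<noteq> {}) else 0)"
          by (auto simp: wG_def)
      qed
      also have "\<dots> = real n * of_bool (V \<noteq> {})" by simp
      finally show "ereal (frob n (wG n V Ed) x) \<le> ereal (real n * Pmax n (wG n V Ed))"
        using P by simp
    qed
  qed
  then show ?thesis by blast
qed

theorem theorem8:
  shows "(\<exists>C N. \<forall>n\<ge>N. \<exists>m r E F g. approx_EF n (real n) m r E F g \<and> real r \<le> C * (real n)^2)
    \<and> (\<forall>\<epsilon>::real. 0 < \<epsilon> \<and> \<epsilon> < 1/2 \<longrightarrow>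
        (\<exists>c>0. \<exists>N. \<forall>n\<ge>N. \<forall>m r E F g.
            approx_EF n (real n powr (1/2 - \<epsilon>)) m r E F g \<longrightarrow>
            real r \<ge> 2 powr (c * real n powr (2 * \<epsilon>))))"
proof (intro conjI allI impI)
  show "\<exists>C N. \<forall>n\<ge>N. \<exists>m r E F g. approx_EF n (real n) m r E F g \<and> real r \<le> C * (real n)^2"
  proof (rule exI[of _ 2], rule exI[of _ 1], intro allI impI)
    fix n :: nat assume "1 \<le> n"
    then obtain m E F g where "approx_EF n (real n) m (2 * (n * n)) E F g"
      using box_approx_EF[of n] by auto
    moreover have "real (2 * (n * n)) \<le> 2 * (real n)^2" by (simp add: power2_eq_square)
    ultimately show "\<exists>m r E F g. approx_EF n (real n) m r E F g \<and> real r \<le> 2 * (real n)^2"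
      by blast
  qed
next
  fix \<epsilon> :: real assume \<epsilon>: "0 < \<epsilon> \<and> \<epsilon> < 1/2"
  then have "0 < \<epsilon>" by simp
  \<comment> \<open>For \<open>\<rho> = n powr (1/2 - \<epsilon>)\<close> the ratio
    \<open>n / \<rho>^2\<close> is \<open>n powr (2 * \<epsilon>)\<close>. Halving the rate 1/1024
    leaves room for the polynomial factor.\<close>
  then have "eventually (\<lambda>n::nat. 2048 * (real n)\<^sup>2 * 2 powr (1/2048 * real n powr (2 * \<epsilon>))
      \<le> exp (real n powr (2 * \<epsilon>) / 1024)) at_top"
    by real_asymp
  then obtain N where N: "\<And>n. N \<le> n \<Longrightarrow> 2048 * (real n)\<^sup>2 * 2 powr (1/2048 * real n powr (2 * \<epsilon>))
      \<le> exp (real n powr (2 * \<epsilon>) / 1024)"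
    unfolding eventually_sequentially by blast
  show "\<exists>c>0. \<exists>N. \<forall>n\<ge>N. \<forall>m r E F g. approx_EF n (real n powr (1/2 - \<epsilon>)) m r E F g \<longrightarrow>
      2 powr (c * real n powr (2 * \<epsilon>)) \<le> real r"
  proof (intro exI[of _ "1/2048"] exI[of _ "max N 1"] conjI allI impI)
    fix n m r E F g
    assume n: "max N 1 \<le> n" and EF: "approx_EF n (real n powr (1/2 - \<epsilon>)) m r E F g"
    define x where "x = real n powr (2 * \<epsilon>)"
    define \<rho> where "\<rho> = real n powr (1/2 - \<epsilon>)"
    have n1: "1 \<le> real n" using n by simp
    have \<rho>: "1 \<le> \<rho>" "\<rho> \<le> real n"
      using n1 \<epsilon> powr_mono[of "1/2 - \<epsilon>" 1 "real n"] by (auto simp: \<rho>_def ge_one_powr_ge_zero)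
    have "\<rho>\<^sup>2 * x = real n powr ((1/2 - \<epsilon>) + (1/2 - \<epsilon>) + 2 * \<epsilon>)"
      unfolding \<rho>_def x_def power2_eq_square powr_add ..
    also have "\<dots> = real n" using n1 by simp
    finally have exponent: "real n / (1024 * \<rho>\<^sup>2) = x / 1024" using \<rho>(1) by (auto simp: field_simps)
    have "exp (x / 1024) \<le> 1024 * (real n)\<^sup>2 * (real r + 1)"
      using approx_EF_size_lower_bound[OF EF[folded \<rho>_def] \<rho>] n unfolding exponent by simp
    moreover have "2048 * (real n)\<^sup>2 * 2 powr (1/2048 * x) \<le> exp (x / 1024)"
      using N[of n] n by (simp add: x_def)
    ultimately have "1024 * (real n)\<^sup>2 * (2 * 2 powr (1/2048 * x)) \<le> 1024 * (real n)\<^sup>2 * (real r + 1)"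
      by linarith
    then have "2 * 2 powr (1/2048 * x) \<le> real r + 1"
      by (rule mult_left_le_imp_le) (use n in auto)
    \<comment> \<open>The spare factor 2 in 2048 absorbs the \<open>+ 1\<close> from the constant
      term of the factorization.\<close>
    moreover have "1 \<le> 2 powr (1/2048 * x)"
      by (intro ge_one_powr_ge_zero) (auto simp: x_def)
    ultimately show "2 powr (1/2048 * real n powr (2 * \<epsilon>)) \<le> real r"
      unfolding x_def by linarith
  qed simp
qed

end
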